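(* There is no injective germ of reflection map $f\colon(\mathbb C^n,0)\to(\mathbb C^p,0)$ with $\operatorname{corank} f>p-n$. In particular, there is no injective germ of reflection map $(\mathbb C^2,0)\to(\mathbb C^3,0)$ of corank $2$.
   Context: Let $V$ be a $p$-dimensional complex vector space with a fixed positive definite hermitian form. A reflection on $V$ is a unitary linear map of finite order whose fixed space has dimension $\dim V-1$. A reflection group is a finite subgroup $G\le\mathrm U(V)$ generated by reflections. By Shephard--Todd, $\mathbb C[V]^G$ is generated by $p$ homogeneous algebraically independent polynomials $\omega_1,\dots,\omega_p$; the orbit map of $G$ is $\omega=(\omega_1,\dots,\omega_p)\colon V\to\mathbb C^p$. A germ of reflection map is a germ $f=\omega\circ h\colon(\mathbb C^n,0)\to(\mathbb C^p,0)$, where $h\colon(\mathbb C^n,0)\to(V,0)$ is a germ of embedding and $\omega$ is the orbit map of some reflection group $G$ on $V$. The corank of $f$ is $\dim_{\mathbb C}\ker df_0$. A germ is injective if it has an injective representative on some neighbourhood of $0$. *)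

theory Defs
  imports "HOL-Analysis.Analysis" "HOL-Algebra.Generated_Groups" "HOL-Library.Poly_Mapping"
begin

text \<open>
  The \<open>p\<close>-dimensional space \<open>V\<close> is \<^typ>\<open>complex^'p\<close> with an arbitrary positive definite
  hermitian form \<open>H\<close>. Complex linearity and complex dimension are taken with respect to
  the scalar multiplication \<open>(*s)\<close>; plain \<open>linear\<close> and \<open>dim\<close> would be real notions.
\<close>

abbreviation clinear_map :: "(complex^'a::finite \<Rightarrow> complex^'b::finite) \<Rightarrow> bool" where
  "clinear_map \<equiv> Vector_Spaces.linear (*s) (*s)"

definition pos_def_hermitian :: "(complex^'p::finite \<Rightarrow> complex^'p \<Rightarrow> complex) \<Rightarrow> bool" where
  "pos_def_hermitian H \<longleftrightarrow>
     (\<forall>u v w. H (u + v) w = H u w + H v w) \<and>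
     (\<forall>c v w. H (c *s v) w = c * H v w) \<and>
     (\<forall>v w. H w v = cnj (H v w)) \<and>
     (\<forall>v. v \<noteq> 0 \<longrightarrow> Re (H v v) > 0)"

definition unitary_map ::
    "(complex^'p::finite \<Rightarrow> complex^'p \<Rightarrow> complex) \<Rightarrow> (complex^'p \<Rightarrow> complex^'p) \<Rightarrow> bool" where
  "unitary_map H g \<longleftrightarrow> clinear_map g \<and> (\<forall>v w. H (g v) (g w) = H v w)"

definition unitary_group ::
    "(complex^'p::finite \<Rightarrow> complex^'p \<Rightarrow> complex) \<Rightarrow> (complex^'p \<Rightarrow> complex^'p) monoid" where
  "unitary_group H = \<lparr>carrier = {g. unitary_map H g}, mult = (\<circ>), one = id\<rparr>"

definition reflection ::
    "(complex^'p::finite \<Rightarrow> complex^'p \<Rightarrow> complex) \<Rightarrow> (complex^'p \<Rightarrow> complex^'p) \<Rightarrow> bool" where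
  "reflection H r \<longleftrightarrow>
     unitary_map H r \<and> (\<exists>m>0. r ^^ m = id) \<and> vec.dim {v. r v = v} + 1 = CARD('p)"

definition reflection_group ::
    "(complex^'p::finite \<Rightarrow> complex^'p \<Rightarrow> complex) \<Rightarrow> (complex^'p \<Rightarrow> complex^'p) set \<Rightarrow> bool" where
  "reflection_group H G \<longleftrightarrow>
     finite G \<and> subgroup G (unitary_group H) \<and>
     (\<exists>R. (\<forall>r\<in>R. reflection H r) \<and> G = generate (unitary_group H) R)"

text \<open>
  Polynomials in the variables \<open>X\<^sub>i\<close>, \<open>i :: 'p\<close>, are finitely supported families of
  coefficients indexed by exponent vectors. Since the complex numbers are infinite,
  polynomials on \<open>V\<close> may be identified with the functions they induce.
\<close>

type_synonym 'p cpoly = "('p \<Rightarrow>\<^sub>0 nat) \<Rightarrow>\<^sub>0 complex"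

definition poly_eval :: "'p::finite cpoly \<Rightarrow> complex^'p \<Rightarrow> complex" where
  "poly_eval P x =
     (\<Sum>m\<in>Poly_Mapping.keys P. Poly_Mapping.lookup P m * (\<Prod>i\<in>UNIV. (x $ i) ^ Poly_Mapping.lookup m i))"

definition homogeneous_poly :: "nat \<Rightarrow> 'p::finite cpoly \<Rightarrow> bool" where
  "homogeneous_poly d P \<longleftrightarrow>
     (\<forall>m\<in>Poly_Mapping.keys P. (\<Sum>i\<in>UNIV. Poly_Mapping.lookup m i) = d)"

definition invariant_ring ::
    "(complex^'p::finite \<Rightarrow> complex^'p) set \<Rightarrow> (complex^'p \<Rightarrow> complex) set" where
  "invariant_ring G = {\<phi>. (\<exists>P. \<phi> = poly_eval P) \<and> (\<forall>g\<in>G. \<forall>v. \<phi> (g v) = \<phi> v)}"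

text \<open>
  The last two conditions below are algebraic independence of the components of \<open>\<omega>\<close>,
  and that they generate the invariant ring as an algebra: its elements are
  exactly the polynomial expressions in them.
\<close>

definition orbit_map ::
    "(complex^'p::finite \<Rightarrow> complex^'p) set \<Rightarrow> (complex^'p \<Rightarrow> complex^'p) \<Rightarrow> bool" where
  "orbit_map G \<omega> \<longleftrightarrow>
     (\<forall>i. \<exists>d P. homogeneous_poly d P \<and> (\<forall>v. \<omega> v $ i = poly_eval P v)) \<and>
     (\<forall>Q. (\<forall>v. poly_eval Q (\<omega> v) = 0) \<longrightarrow> Q = 0) \<and>
     invariant_ring G = {\<lambda>v. poly_eval Q (\<omega> v) |Q. True}"

definition holomorphic_map_on ::
    "(complex^'n::finite) set \<Rightarrow> (complex^'n \<Rightarrow> complex^'p::finite) \<Rightarrow> bool" where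
  "holomorphic_map_on U h \<longleftrightarrow>
     (\<forall>x\<in>U. \<exists>D. clinear_map D \<and> (h has_derivative D) (at x))"

text \<open>
  A germ at \<open>0\<close> is represented by a total function of which only the values near \<open>0\<close>
  matter; all predicates below are invariant under changing it away from \<open>0\<close>.
\<close>

definition embedding_germ :: "(complex^'n::finite \<Rightarrow> complex^'p::finite) \<Rightarrow> bool" where
  "embedding_germ h \<longleftrightarrow> h 0 = 0 \<and>
     (\<exists>U. open U \<and> 0 \<in> U \<and> holomorphic_map_on U h \<and>
          (\<forall>x\<in>U. inj (frechet_derivative h (at x))) \<and>
          (\<exists>k. homeomorphism U (h ` U) h k))"

definition reflection_map_germ :: "(complex^'n::finite \<Rightarrow> complex^'p::finite) \<Rightarrow> bool" where
  "reflection_map_germ f \<longleftrightarrow>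
     (\<exists>H G \<omega> h. pos_def_hermitian H \<and> reflection_group H G \<and> orbit_map G \<omega> \<and>
        embedding_germ h \<and> (\<forall>\<^sub>F x in nhds 0. f x = \<omega> (h x)))"

definition corank :: "(complex^'n::finite \<Rightarrow> complex^'p::finite) \<Rightarrow> nat" where
  "corank f = vec.dim {v. frechet_derivative f (at 0) v = 0}"

definition injective_germ :: "(complex^'n::finite \<Rightarrow> complex^'p::finite) \<Rightarrow> bool" where
  "injective_germ f \<longleftrightarrow> (\<exists>U. open U \<and> 0 \<in> U \<and> inj_on f U)"

end

theory Submission
  imports Defs "HOL-Complex_Analysis.Conformal_Mappings"
begin

text \<open>
  Write \<open>f = \<omega> \<circ> h\<close> near \<open>0\<close>, let \<open>T\<close> be the derivative of
  \<open>h\<close> at \<open>0\<close>, and let \<open>V\<^sup>G\<close> be the space of vectors fixed by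
  \<open>G\<close>. The inequality behind the result is \<open>corank f + n \<le> p\<close> for every injective
  germ of reflection map \<open>f\<close>. It comes from comparing two estimates of \<open>d = dim {x. T x \<in>
  V\<^sup>G}\<close>.

  Upper bound, \<open>d \<le> n - corank f\<close>. For \<open>u \<in> V\<^sup>G\<close> the linear form
  \<open>H(\<cdot>, u)\<close> is invariant, hence a polynomial in \<open>\<omega>\<close>; differentiating this
  identity at \<open>0\<close> in direction \<open>u\<close> shows that the derivative of
  \<open>\<omega>\<close> at \<open>0\<close> is injective on \<open>V\<^sup>G\<close>. So the kernel of the
  derivative of \<open>f\<close> meets \<open>{x. T x \<in> V\<^sup>G}\<close> only in \<open>0\<close>.

  Lower bound, \<open>d \<ge> 2n - p\<close>. Because \<open>\<omega> \<circ> g = \<omega>\<close> for \<open>g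
  \<in> G\<close>, injectivity of \<open>f\<close> says that \<open>h x = g (h y)\<close> forces \<open>x =
  y\<close>: the image \<open>Y\<close> of \<open>h\<close> and its translate \<open>g Y\<close> meet only in
  fixed points of \<open>g\<close>. Some \<open>g \<in> G\<close> fixes nothing outside \<open>V\<^sup>G\<close>
  (\<open>reflection_group_has_generic_element\<close>), and for this \<open>g\<close> the intersection of
  \<open>Y\<close> and \<open>g Y\<close> lies in \<open>V\<^sup>G\<close>. Two \<open>n\<close>-dimensional
  manifolds through a point of \<open>p\<close>-space meet in dimension at least \<open>2n - p\<close>, whereas
  the part of \<open>Y\<close> in \<open>V\<^sup>G\<close> has dimension at most \<open>d\<close>. To make this
  precise without a dimension theory of analytic sets, suppose \<open>d < 2n - p\<close>. Then some
  \<open>(p+1)\<close>-dimensional space of pairs \<open>(x, y)\<close> avoids the diagonal copy of \<open>{x. T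
  x \<in> V\<^sup>G}\<close>, and on that space the \<open>p\<close> equations \<open>h x = g (h y)\<close> have
  an isolated solution at \<open>0\<close>. This contradicts \<open>no_isolated_zero\<close>: a holomorphic map
  into a space of smaller dimension has no isolated zero.

  For \<open>no_isolated_zero\<close>, perturb the map \<open>F\<close> to \<open>F + A\<close> with a small
  matrix \<open>A\<close> and look at the fibre over a small value \<open>c\<close>. If \<open>0\<close> were an
  isolated zero of \<open>F\<close>, the fibre inside a small ball would be compact. For suitable \<open>(A,
  c)\<close> it is nonempty, and for almost all \<open>(A, c)\<close> it is smooth: the bad parameters are the
  image of a null set under a map that is Lipschitz at each of its points, by the Cauchy estimates for
  derivatives. But a smooth fibre of positive dimension contains a nonconstant holomorphic disc through its
  point of largest norm, against the maximum principle.
\<close>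

section \<open>Complex-linear maps and matrices\<close>

lemma clinear_mapI:
  assumes "\<And>u v. f (u + v) = f u + f v" "\<And>c v. f (c *s v) = c *s f v"
  shows "clinear_map f"
  by unfold_locales (use assms in auto)

lemma scaleR_eq_scale: "r *\<^sub>R (v::complex^'n) = complex_of_real r *s v"
  by (simp add: vec_eq_iff scaleR_conv_of_real[where 'a=complex])

lemma clinear_map_imp_linear:
  assumes "clinear_map f"
  shows "linear f"
proof (rule linearI)
  show "f (u + v) = f u + f v" for u v
    using assms by (rule vec.linear_add)
  show "f (r *\<^sub>R v) = r *\<^sub>R f v" for r v
    using assms by (simp add: scaleR_eq_scale vec.linear_scale)
qed

lemma clinear_map_imp_bounded_linear: "clinear_map f \<Longrightarrow> bounded_linear f"
  using clinear_map_imp_linear linear_conv_bounded_linear by blast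

lemma dist_add_le: "dist x (y + v) \<le> dist x y + norm (v::'a::real_normed_vector)"
  using norm_triangle_ineq4[of "x - y" v] by (simp add: dist_norm algebra_simps)

lemma norm_vec_le_sum: "norm (x::'a::real_normed_vector^'n) \<le> (\<Sum>i\<in>UNIV. norm (x $ i))"
  unfolding norm_vec_def by (rule L2_set_le_sum) simp

lemma norm_scale_axis [simp]: "norm (t *s axis j 1 :: complex^'n) = norm t"
proof -
  have "t *s axis j 1 = axis j t" by (simp add: vec_eq_iff axis_def)
  then show ?thesis 
    by (simp add: norm_vec_def L2_set_def axis_def if_distrib[of norm] if_distrib[of "\<lambda>x. x\<^sup>2"] cong: if_cong)
qed

lemma norm_matrix_le:
  fixes A :: "complex^'n^'m"
  assumes "\<And>i j. norm (A $ i $ j) \<le> B"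
  shows "norm A \<le> real CARD('m) * real CARD('n) * B"
proof -
  have "norm (A $ i) \<le> real CARD('n) * B" for i
    using norm_vec_le_sum[of "A $ i"] sum_mono[of UNIV "\<lambda>j. norm (A $ i $ j)" "\<lambda>_. B"] assms
    by fastforce
  then show ?thesis
    using norm_vec_le_sum[of A] sum_mono[of UNIV "\<lambda>i. norm (A $ i)" "\<lambda>_. real CARD('n) * B"]
    by (fastforce simp: mult.assoc)
qed

lemma norm_matrix_vector_mult_le:
  fixes A :: "complex^'n^'m"
  assumes "\<And>i j. norm (A $ i $ j) \<le> B"
  shows "norm (A *v v) \<le> real CARD('m) * real CARD('n) * B * norm v"
proof -
  have B: "0 \<le> B" using assms norm_ge_zero order_trans by blast
  have "norm ((A *v v) $ i) \<le> real CARD('n) * (B * norm v)" for i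
  proof -
    have "norm ((A *v v) $ i) \<le> (\<Sum>j\<in>UNIV. norm (A $ i $ j * v $ j))"
      unfolding matrix_vector_mult_def by (simp add: norm_sum)
    also have "\<dots> \<le> (\<Sum>j\<in>(UNIV::'n set). B * norm v)"
      by (intro sum_mono) (auto simp: norm_mult intro!: mult_mono assms Finite_Cartesian_Product.norm_nth_le B)
    finally show ?thesis by simp
  qed
  then have "norm (A *v v) \<le> (\<Sum>i\<in>(UNIV::'m set). real CARD('n) * (B * norm v))"
    using norm_vec_le_sum[of "A *v v"] sum_mono[of UNIV "\<lambda>i. norm ((A *v v) $ i)"]
    by (meson order_trans)
  then show ?thesis by (simp add: mult.assoc)
qed

lemma wide_matrix_has_kernel:
  fixes A :: "complex^'n^'m"
  assumes "CARD('m) < CARD('n)"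
  obtains k where "k \<noteq> 0" "A *v k = 0"
proof -
  have "\<not> inj ((*v) A)"
  proof
    assume "inj ((*v) A)"
    then have "vec.dim (range ((*v) A)) = vec.dim (UNIV :: (complex^'n) set)"
      by (intro vec.dim_image_eq[OF matrix_vector_mul_linear_gen]) (auto intro: inj_on_subset)
    moreover have "vec.dim (range ((*v) A)) \<le> CARD('m)"
      by (rule dim_subset_UNIV_cart_gen)
    ultimately show False using assms by (simp add: vec_dim_card card_cart_basis)
  qed
  then obtain x y where "x \<noteq> y" "A *v x = A *v y" unfolding inj_def by blast
  then show thesis using that[of "x - y"] by (simp add: matrix_vector_mult_diff_distrib)
qed

lemma inverse_matrix_scale:
  fixes A :: "complex^'n^'n"
  assumes "bij ((*v) A)"
  shows "inv_into UNIV ((*v) A) (t *s v) = t *s inv_into UNIV ((*v) A) v"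
proof -
  let ?g = "inv_into UNIV ((*v) A)"
  have "A *v (t *s ?g v) = t *s v"
    using surj_f_inv_f[OF bij_is_surj[OF assms]] by (simp add: vec.scale)
  then show ?thesis
    using inv_f_f[OF bij_is_inj[OF assms], of "t *s ?g v"] by simp
qed

text \<open>
  Complete a basis of \<open>E\<close> to a basis of the whole space and send the unit vectors to distinct new
  basis vectors. The linear map \<open>\<pi>\<close> that kills \<open>E\<close> and undoes this assignment
  shows that the range meets \<open>E\<close> trivially.
\<close>

lemma clinear_embedding_avoiding_subspace:
  fixes E :: "(complex^'b) set"
  assumes E: "vec.subspace E" and dim: "vec.dim E + CARD('a) \<le> CARD('b)"
  obtains L :: "complex^'a \<Rightarrow> complex^'b" where "clinear_map L" "\<And>s. L s \<in> E \<Longrightarrow> s = 0"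
proof -
  obtain B where B: "B \<subseteq> E" "vec.independent B" "E \<subseteq> vec.span B" "card B = vec.dim E"
    by (rule vec.basis_exists)
  let ?X = "vec.extend_basis B"
  have X: "B \<subseteq> ?X" "vec.independent ?X" "vec.span ?X = UNIV"
    using vec.extend_basis_superset vec.independent_extend_basis vec.span_extend_basis B(2) by auto
  have fin: "finite ?X" using X(2) by (rule vec.finiteI_independent)
  have "card ?X = CARD('b)"
    using vec.dim_eq_card_independent[OF X(2)] X(3) by (metis vec.dim_span vec_dim_card)
  then have "CARD('a) \<le> card (?X - B)"
    using dim B(4) X(1) fin by (simp add: card_Diff_subset finite_subset)
  then obtain e :: "'a \<Rightarrow> complex^'b" where e: "range e \<subseteq> ?X - B" "inj e"
    using card_le_inj[of "UNIV :: 'a set" "?X - B"] fin by auto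
  define c where "c x = (if x \<in> range e then axis (inv_into UNIV e x) 1 else 0 :: complex^'a)" for x
  obtain \<pi> where \<pi>: "clinear_map \<pi>" "\<And>x. x \<in> ?X \<Longrightarrow> \<pi> x = c x"
    using vec.linear_independent_extend[OF X(2), of c] by blast
  define L where "L s = (\<Sum>i\<in>UNIV. s $ i *s e i)" for s :: "complex^'a"
  have "clinear_map L"
    by (rule clinear_mapI)
      (simp_all add: L_def vec.scale_left_distrib sum.distrib vec.scale_sum_right)
  have \<pi>L: "\<pi> (L s) = s" for s
  proof -
    have "\<pi> (e i) = axis i 1" for i
      using e \<pi>(2)[of "e i"] by (auto simp: c_def)
    then show ?thesis
      by (simp add: L_def vec.linear_sum[OF \<pi>(1)] vec.linear_scale[OF \<pi>(1)] basis_expansion)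
  qed
  have "\<pi> x = 0" if "x \<in> E" for x
  proof (rule vec.linear_eq_0_on_span[OF \<pi>(1)])
    show "x \<in> vec.span B" using that B(3) by blast
    show "\<pi> b = 0" if "b \<in> B" for b
    proof -
      have "b \<notin> range e" "b \<in> ?X" using that e(1) X(1) by auto
      then show ?thesis using \<pi>(2) by (simp add: c_def)
    qed
  qed
  then show thesis using that[OF \<open>clinear_map L\<close>] \<pi>L by metis
qed

text \<open>
  The pair \<open>(L1, L2)\<close> embeds \<open>\<complex>\<^sup>a\<close> into \<open>\<complex>\<^sup>n
  \<times> \<complex>\<^sup>n\<close>, encoded with the index type \<^typ>\<open>'n + 'n\<close>, away from the
  diagonal copy of \<open>D\<close>.
\<close>

lemma clinear_embedding_avoiding_diagonal:
  fixes D :: "(complex^'n) set"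
  assumes D: "vec.subspace D" and dim: "vec.dim D + CARD('a) \<le> 2 * CARD('n)"
  obtains L1 L2 :: "complex^'a \<Rightarrow> complex^'n" where "clinear_map L1" "clinear_map L2"
    "\<And>s. L1 s = L2 s \<Longrightarrow> L1 s \<in> D \<Longrightarrow> s = 0"
proof -
  define \<Delta> where "\<Delta> x = (\<chi> k. x $ (case k of Inl i \<Rightarrow> i | Inr i \<Rightarrow> i))" for x :: "complex^'n"
  have \<Delta>: "clinear_map (\<Delta> :: complex^'n \<Rightarrow> complex^('n + 'n))"
    by (rule clinear_mapI) (simp_all add: vec_eq_iff \<Delta>_def)
  have "vec.dim (\<Delta> ` D) + CARD('a) \<le> CARD('n + 'n)"
    using vec.dim_image_le[OF \<Delta>, of D] dim by simp
  then obtain L :: "complex^'a \<Rightarrow> complex^('n + 'n)" where L: "clinear_map L" "\<And>s. L s \<in> \<Delta> ` D \<Longrightarrow> s = 0"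
    by (rule clinear_embedding_avoiding_subspace[OF vec.linear_subspace_image[OF \<Delta> D]]) blast
  show thesis
  proof (rule that[of "\<lambda>s. \<chi> i. L s $ Inl i" "\<lambda>s. \<chi> i. L s $ Inr i"])
    show "clinear_map (\<lambda>s. \<chi> i. L s $ Inl i)" "clinear_map (\<lambda>s. \<chi> i. L s $ Inr i)"
      by (rule clinear_mapI;
          simp add: vec_eq_iff vec.linear_add[OF L(1)] vec.linear_scale[OF L(1)])+
    fix s assume eq: "(\<chi> i. L s $ Inl i) = (\<chi> i. L s $ Inr i)" and "(\<chi> i. L s $ Inl i) \<in> D"
    moreover have "L s = \<Delta> (\<chi> i. L s $ Inl i)"
      using eq by (auto simp: vec_eq_iff \<Delta>_def split: sum.split)
    ultimately show "s = 0" using L(2) by blast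
  qed
qed

section \<open>Complex Jacobians and Cauchy estimates\<close>

lemma has_derivative_vec:
  fixes f :: "'a::real_normed_vector \<Rightarrow> 'b::euclidean_space^'n"
  assumes "\<And>i. ((\<lambda>x. f x $ i) has_derivative (\<lambda>x. f' x $ i)) (at a within S)"
  shows "(f has_derivative f') (at a within S)"
  unfolding has_derivative_componentwise_within[of f]
proof
  fix b :: "'b^'n" assume "b \<in> Basis"
  then obtain i u where "b = axis i u" by (auto simp: Basis_vec_def)
  then show "((\<lambda>x. f x \<bullet> b) has_derivative (\<lambda>x. f' x \<bullet> b)) (at a within S)"
    using has_derivative_inner_left[OF assms[of i], of u] by (simp add: inner_axis)
qed

text \<open>
  All differentials are represented by complex matrices, so that complex linearity is built in and the
  derivative is a function into a normed space.
\<close>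

definition cjacobian :: "(complex^'n \<Rightarrow> complex^'m) \<Rightarrow> complex^'n \<Rightarrow> complex^'n^'m" where
  "cjacobian F x = matrix (frechet_derivative F (at x))"

lemma cjacobian_eqI:
  assumes "(F has_derivative ((*v) A)) (at x)"
  shows "cjacobian F x = A"
  using frechet_derivative_at[OF assms] unfolding cjacobian_def by (metis matrix_of_matrix_vector_mul)

lemma has_derivative_cjacobian:
  assumes "holomorphic_map_on U F" "x \<in> U"
  shows "(F has_derivative ((*v) (cjacobian F x))) (at x)"
proof -
  obtain D where D: "clinear_map D" "(F has_derivative D) (at x)"
    using assms unfolding holomorphic_map_on_def by blast
  have "D = (*v) (matrix D)"
    using matrix_works[OF D(1)] by auto
  then show ?thesis
    using D(2) cjacobian_eqI by metis
qed

lemma holomorphic_map_onI: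
  assumes "\<And>x. x \<in> U \<Longrightarrow> (F has_derivative ((*v) (A x))) (at x)"
  shows "holomorphic_map_on U F"
  unfolding holomorphic_map_on_def using assms matrix_vector_mul_linear_gen by blast

lemma holomorphic_map_on_imp_continuous_on:
  "holomorphic_map_on U F \<Longrightarrow> continuous_on U F"
  by (meson continuous_at_imp_continuous_on has_derivative_continuous has_derivative_cjacobian)

lemma has_field_derivative_along_line:
  assumes "holomorphic_map_on U F" "x + t *s v \<in> U"
  shows "((\<lambda>t. F (x + t *s v) $ i) has_field_derivative (cjacobian F (x + t *s v) *v v) $ i) (at t)"
proof -
  have b: "bounded_linear (\<lambda>t::complex. t *s v)"
    by (intro bounded_linearI') (auto simp: vec_eq_iff algebra_simps)
  have "((\<lambda>t. x + t *s v) has_derivative (\<lambda>t. t *s v)) (at t)"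
    using has_derivative_add[OF has_derivative_const bounded_linear_imp_has_derivative[OF b]]
    by simp
  from has_derivative_compose[OF this has_derivative_cjacobian[OF assms]]
  have "((\<lambda>t. F (x + t *s v)) has_derivative (\<lambda>s. cjacobian F (x + t *s v) *v (s *s v))) (at t)" .
  from bounded_linear.has_derivative[OF bounded_linear_vec_nth this]
  show ?thesis
    unfolding has_field_derivative_def
    by (rule has_derivative_eq_rhs) (simp add: fun_eq_iff vec.scale mult.commute)
qed

text \<open>
  The entry \<open>(i, j)\<close> is the derivative at \<open>0\<close> of the \<open>i\<close>-th component
  along the \<open>j\<close>-th complex line, so the estimate is Cauchy's inequality in one variable.
\<close>

lemma cjacobian_Cauchy_bound:
  assumes F: "holomorphic_map_on U F" and r: "0 < r"
    and U: "\<And>t. norm t \<le> r \<Longrightarrow> x + t *s axis j 1 \<in> U"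
    and B: "\<And>t. norm t \<le> r \<Longrightarrow> norm (F (x + t *s axis j 1)) \<le> B"
  shows "norm (cjacobian F x $ i $ j) \<le> B / r"
proof -
  let ?\<phi> = "\<lambda>t. F (x + t *s axis j 1) $ i"
  have d: "(?\<phi> has_field_derivative (cjacobian F (x + t *s axis j 1) *v axis j 1) $ i) (at t)"
    if "norm t \<le> r" for t
    using has_field_derivative_along_line[OF F U[OF that]] .
  have "?\<phi> holomorphic_on ball 0 r"
    by (rule holomorphic_onI, rule field_differentiable_at_within)
      (use d less_imp_le in \<open>fastforce simp: field_differentiable_def\<close>)
  moreover have "continuous_on (cball 0 r) ?\<phi>"
    by (rule continuous_at_imp_continuous_on) (use d DERIV_isCont in fastforce)
  ultimately have "norm ((deriv ^^ 1) ?\<phi> 0) \<le> fact 1 * B / r ^ 1"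
    using r B by (intro Cauchy_inequality) (auto intro: order_trans[OF Finite_Cartesian_Product.norm_nth_le])
  moreover have "deriv ?\<phi> 0 = (cjacobian F (x + 0 *s axis j 1) *v axis j 1) $ i"
    using r by (intro DERIV_imp_deriv d) auto
  ultimately show ?thesis
    by (simp add: matrix_vector_mult_def axis_def if_distrib[of "(*) _"] cong: if_cong)
qed

text \<open>
  \<open>F\<close> is bounded on a compact ball, the Cauchy bound then controls all entries of the Jacobian on
  the ball of half the radius, and the mean value inequality applies.
\<close>

lemma holomorphic_map_Lipschitz_near:
  fixes F :: "complex^'n \<Rightarrow> complex^'m"
  assumes F: "holomorphic_map_on U F" and "open U" "x \<in> U"
  obtains r L where "0 < r" "cball x r \<subseteq> U"
    "\<And>y z. y \<in> cball x r \<Longrightarrow> z \<in> cball x r \<Longrightarrow> norm (F y - F z) \<le> L * norm (y - z)"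
proof -
  obtain e where e: "0 < e" "cball x e \<subseteq> U"
    using assms open_contains_cball by blast
  define r where "r = e / 2"
  have r: "0 < r" "cball x (r + r) \<subseteq> U" "cball x r \<subseteq> U" using e by (auto simp: r_def)
  have "compact (F ` cball x (r + r))"
    using holomorphic_map_on_imp_continuous_on[OF F] r continuous_on_subset
    by (intro compact_continuous_image) auto
  then obtain C where C: "\<And>y. y \<in> cball x (r + r) \<Longrightarrow> norm (F y) \<le> C"
    by (meson compact_imp_bounded bounded_iff imageI)
  have near: "y + t *s axis j 1 \<in> cball x (r + r)" if "y \<in> cball x r" "norm t \<le> r" for y t j
  proof -
    show ?thesis using that dist_add_le[of x y "t *s axis j 1"] by simp
  qed
  have J: "norm (cjacobian F y $ i $ j) \<le> C / r" if "y \<in> cball x r" for y i j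
    using that near r C by (intro cjacobian_Cauchy_bound[OF F]) blast+
  show thesis
  proof (rule that[OF r(1) r(3)])
    fix y z assume yz: "y \<in> cball x r" "z \<in> cball x r"
    show "norm (F y - F z) \<le> (real CARD('m) * real CARD('n) * (C / r)) * norm (y - z)"
    proof (rule differentiable_bound[OF convex_cball[of x r] _ _ yz])
      show "(F has_derivative (*v) (cjacobian F w)) (at w within cball x r)" if "w \<in> cball x r" for w
        using has_derivative_cjacobian[OF F] that r has_derivative_at_withinI by blast
      show "onorm ((*v) (cjacobian F w)) \<le> real CARD('m) * real CARD('n) * (C / r)" if "w \<in> cball x r" for w
        by (rule onorm_le) (rule norm_matrix_vector_mult_le[OF J[OF that]])
    qed
  qed
qed

text \<open>
  Second derivatives are avoided: the Cauchy bound is applied to the difference \<open>F(z + d) - F(z)\<close>,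
  whose Jacobian is the increment of the Jacobian of \<open>F\<close> and whose size is at most a multiple of
  the norm of \<open>d\<close>.
\<close>

lemma cjacobian_Lipschitz_at:
  fixes F :: "complex^'n \<Rightarrow> complex^'m"
  assumes F: "holomorphic_map_on U F" and U: "open U" "x \<in> U"
  obtains r B where "0 < r" "\<And>y. y \<in> ball x r \<Longrightarrow> norm (cjacobian F y - cjacobian F x) \<le> B * norm (y - x)"
proof -
  obtain e L where e: "0 < e" "cball x e \<subseteq> U"
    and L: "\<And>y z. y \<in> cball x e \<Longrightarrow> z \<in> cball x e \<Longrightarrow> norm (F y - F z) \<le> L * norm (y - z)"
    by (rule holomorphic_map_Lipschitz_near[OF F U]) blast
  define r where "r = e / 2"
  have r: "0 < r" "r + r = e" using e by (auto simp: r_def)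
  let ?B = "real CARD('m) * real CARD('n) * (L / r)"
  show thesis
  proof (rule that[OF r(1)])
    fix y assume y: "y \<in> ball x r"
    define d where "d = y - x"
    have d: "norm d < r" using y by (simp add: d_def dist_norm norm_minus_commute)
    let ?G = "\<lambda>z. F (z + d) - F z"
    have in_e: "z \<in> cball x e" "z + d \<in> cball x e" if "z \<in> cball x r" for z
    proof -
      show "z \<in> cball x e" using that r by auto
      show "z + d \<in> cball x e" using that r d dist_add_le[of x z d] by auto
    qed
    have der: "(?G has_derivative ((*v) (cjacobian F (z + d) - cjacobian F z))) (at z)"
      if "z \<in> cball x r" for z
    proof -
      have 1: "(F has_derivative ((*v) (cjacobian F (z + d)))) (at (z + d))"
        and 2: "(F has_derivative ((*v) (cjacobian F z))) (at z)"
        using in_e[OF that] e by (auto intro!: has_derivative_cjacobian[OF F])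
      have "((\<lambda>z. F (z + d)) has_derivative ((*v) (cjacobian F (z + d)))) (at z)"
        by (rule has_derivative_compose[where f = "\<lambda>z. z + d" and f' = "\<lambda>z. z", OF _ 1])
          (auto intro!: derivative_eq_intros)
      from has_derivative_diff[OF this 2] show ?thesis
        by (rule has_derivative_eq_rhs) (simp add: fun_eq_iff matrix_vector_mult_diff_rdistrib)
    qed
    have G: "holomorphic_map_on (cball x r) ?G"
      by (rule holomorphic_map_onI) (rule der)
    have "norm ((cjacobian F y - cjacobian F x) $ i $ j) \<le> L * norm d / r" for i j
    proof -
      have "cjacobian ?G x = cjacobian F (x + d) - cjacobian F x"
        using der[of x] r by (intro cjacobian_eqI) auto
      moreover have "norm (cjacobian ?G x $ i $ j) \<le> L * norm d / r"
      proof (rule cjacobian_Cauchy_bound[OF G r(1)])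
        fix t :: complex assume t: "norm t \<le> r"
        show in_r: "x + t *s axis j 1 \<in> cball x r" using t dist_add_le[of x x "t *s axis j 1"] by simp
        show "norm (?G (x + t *s axis j 1)) \<le> L * norm d"
          using L[of "x + t *s axis j 1 + d" "x + t *s axis j 1"] in_e[OF in_r] by simp
      qed
      ultimately show ?thesis by (simp add: d_def)
    qed
    from norm_matrix_le[OF this]
    show "norm (cjacobian F y - cjacobian F x) \<le> ?B * norm (y - x)"
      by (simp add: d_def mult.assoc divide_inverse mult.left_commute mult.commute)
  qed
qed

section \<open>Calm functions\<close>

text \<open>
  A Lipschitz condition between \<open>x\<close> and its neighbours only. It holds for differentiable functions
  and for Jacobians of holomorphic maps alike, it is stable under composition, and it is enough to map null sets
  to null sets.
\<close>

definition calm_at :: "('a::real_normed_vector \<Rightarrow> 'b::real_normed_vector) \<Rightarrow> 'a \<Rightarrow> bool" where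
  "calm_at f x \<longleftrightarrow> (\<exists>B. \<forall>\<^sub>F y in nhds x. norm (f y - f x) \<le> B * norm (y - x))"

lemma calm_atE:
  assumes "calm_at f x"
  obtains B where "0 \<le> B" "\<forall>\<^sub>F y in nhds x. norm (f y - f x) \<le> B * norm (y - x)"
proof -
  obtain B where B: "\<forall>\<^sub>F y in nhds x. norm (f y - f x) \<le> B * norm (y - x)"
    using assms unfolding calm_at_def by blast
  have "\<forall>\<^sub>F y in nhds x. norm (f y - f x) \<le> max 0 B * norm (y - x)"
    using B by eventually_elim (meson max.cobounded2 mult_right_mono norm_ge_zero order_trans)
  then show thesis using that by (meson max.cobounded1)
qed

lemma calm_at_imp_tendsto:
  assumes "calm_at f x"
  shows "(f \<longlongrightarrow> f x) (nhds x)"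
proof -
  obtain B where B: "\<forall>\<^sub>F y in nhds x. norm (f y - f x) \<le> B * norm (y - x)"
    using assms unfolding calm_at_def by blast
  have "((\<lambda>y. B * norm (y - x)) \<longlongrightarrow> B * norm (x - x)) (nhds x)"
    by (intro tendsto_intros filterlim_ident)
  then have "((\<lambda>y. f y - f x) \<longlongrightarrow> 0) (nhds x)"
    using Lim_null_comparison[OF B] by simp
  then show ?thesis by (simp add: LIM_zero_iff)
qed

lemma differentiable_imp_calm_at:
  assumes "f differentiable (at x)"
  shows "calm_at f x"
proof -
  obtain D where D: "(f has_derivative D) (at x)"
    using assms unfolding differentiable_def by blast
  then have "bounded_linear D" by (rule has_derivative_bounded_linear)
  then obtain K where K: "\<And>v. norm (D v) \<le> norm v * K" using bounded_linear.bounded by blast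
  obtain d where d: "0 < d" "\<And>y. norm (y - x) < d \<Longrightarrow> norm (f y - f x - D (y - x)) \<le> 1 * norm (y - x)"
    using D zero_less_one unfolding has_derivative_at_alt by blast
  have "norm (f y - f x) \<le> (1 + K) * norm (y - x)" if "norm (y - x) < d" for y
    using d(2)[OF that] K[of "y - x"] norm_triangle_sub[of "f y - f x" "D (y - x)"]
    by (simp add: algebra_simps)
  then show ?thesis
    unfolding calm_at_def eventually_nhds_metric using d(1) by (metis dist_norm)
qed

lemma bounded_linear_imp_calm_at: "bounded_linear f \<Longrightarrow> calm_at f x"
  by (intro differentiable_imp_calm_at bounded_linear_imp_differentiable)

lemma calm_at_compose:
  assumes f: "calm_at f x" and g: "calm_at g (f x)"
  shows "calm_at (\<lambda>y. g (f y)) x"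
proof -
  obtain B where B: "0 \<le> B" "\<forall>\<^sub>F y in nhds x. norm (f y - f x) \<le> B * norm (y - x)"
    using f by (rule calm_atE)
  obtain C where C: "0 \<le> C" "\<forall>\<^sub>F z in nhds (f x). norm (g z - g (f x)) \<le> C * norm (z - f x)"
    using g by (rule calm_atE)
  have "\<forall>\<^sub>F y in nhds x. norm (g (f y) - g (f x)) \<le> C * norm (f y - f x)"
    using calm_at_imp_tendsto[OF f] C(2) unfolding filterlim_iff by blast
  with B(2) have "\<forall>\<^sub>F y in nhds x. norm (g (f y) - g (f x)) \<le> (C * B) * norm (y - x)"
  proof eventually_elim
    case (elim y)
    then have "norm (g (f y) - g (f x)) \<le> C * (B * norm (y - x))"
      using mult_left_mono[OF _ C(1)] order_trans by blast
    then show ?case by (simp add: mult.assoc)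
  qed
  then show ?thesis unfolding calm_at_def by blast
qed

lemma calm_at_Pair:
  assumes f: "calm_at f x" and g: "calm_at g x"
  shows "calm_at (\<lambda>y. (f y, g y)) x"
proof -
  obtain B C where B: "\<forall>\<^sub>F y in nhds x. norm (f y - f x) \<le> B * norm (y - x)"
    and C: "\<forall>\<^sub>F y in nhds x. norm (g y - g x) \<le> C * norm (y - x)"
    using f g unfolding calm_at_def by blast
  from B C have "\<forall>\<^sub>F y in nhds x. norm ((f y, g y) - (f x, g x)) \<le> (B + C) * norm (y - x)"
  proof eventually_elim
    case (elim y)
    then show ?case
      using norm_Pair_le[of "f y - f x" "g y - g x"] by (simp add: algebra_simps)
  qed
  then show ?thesis unfolding calm_at_def by blast
qed

lemma calm_at_vec_lambda:
  fixes f :: "'i::finite \<Rightarrow> 'a::real_normed_vector \<Rightarrow> 'b::real_normed_vector"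
  assumes "\<And>i. calm_at (f i) x"
  shows "calm_at (\<lambda>y. \<chi> i. f i y) x"
proof -
  obtain B where "\<forall>\<^sub>F y in nhds x. norm (f i y - f i x) \<le> B i * norm (y - x)" for i
    using assms unfolding calm_at_def by metis
  then have "\<forall>\<^sub>F y in nhds x. \<forall>i. norm (f i y - f i x) \<le> B i * norm (y - x)"
    by (intro eventually_all_finite) auto
  then have "\<forall>\<^sub>F y in nhds x. norm ((\<chi> i. f i y) - (\<chi> i. f i x)) \<le> (\<Sum>i\<in>UNIV. B i) * norm (y - x)"
  proof eventually_elim
    case (elim y)
    then show ?case
      using norm_vec_le_sum[of "(\<chi> i. f i y) - (\<chi> i. f i x)"]
        sum_mono[of UNIV "\<lambda>i. norm (f i y - f i x)" "\<lambda>i. B i * norm (y - x)"]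
      by (simp add: sum_distrib_right)
  qed
  then show ?thesis unfolding calm_at_def by blast
qed

lemma calm_at_add:
  assumes "calm_at f x" "calm_at g x"
  shows "calm_at (\<lambda>y. f y + g y) x"
proof -
  have "calm_at (\<lambda>p. fst p + snd p) (f x, g x)"
    by (intro differentiable_imp_calm_at differentiable_add) (auto intro!: bounded_linear_imp_differentiable bounded_linear_fst bounded_linear_snd)
  from calm_at_compose[OF calm_at_Pair[OF assms] this] show ?thesis by simp
qed

lemma calm_at_diff:
  assumes "calm_at f x" "calm_at g x"
  shows "calm_at (\<lambda>y. f y - g y) x"
proof -
  have "calm_at (\<lambda>p. fst p - snd p) (f x, g x)"
    by (intro differentiable_imp_calm_at differentiable_diff) (auto intro!: bounded_linear_imp_differentiable bounded_linear_fst bounded_linear_snd)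
  from calm_at_compose[OF calm_at_Pair[OF assms] this] show ?thesis by simp
qed

lemma calm_at_mult:
  fixes f g :: "'a::real_normed_vector \<Rightarrow> complex"
  assumes "calm_at f x" "calm_at g x"
  shows "calm_at (\<lambda>y. f y * g y) x"
proof -
  have "calm_at (\<lambda>p. fst p * snd p) (f x, g x)"
    by (intro differentiable_imp_calm_at differentiable_mult) (auto intro!: bounded_linear_imp_differentiable bounded_linear_fst bounded_linear_snd)
  from calm_at_compose[OF calm_at_Pair[OF assms] this] show ?thesis by simp
qed

lemma calm_at_sum:
  fixes f :: "'i \<Rightarrow> 'a::real_normed_vector \<Rightarrow> 'b::real_normed_vector"
  assumes "\<And>i. i \<in> I \<Longrightarrow> calm_at (f i) x"
  shows "calm_at (\<lambda>y. \<Sum>i\<in>I. f i y) x"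
proof -
  have "calm_at (\<lambda>y. 0) x" by (intro differentiable_imp_calm_at) simp
  with assms show ?thesis
    by (induction I rule: infinite_finite_induct) (auto intro: calm_at_add)
qed

lemma calm_at_matrix_vector_mult: "calm_at (\<lambda>(x, A). A *v x) (x :: complex^'n, A :: complex^'n^'m)"
proof -
  have "calm_at (\<lambda>z. \<chi> i. \<Sum>j\<in>UNIV. snd z $ i $ j * fst z $ j) (x, A)"
    by (intro calm_at_vec_lambda calm_at_sum calm_at_mult bounded_linear_imp_calm_at
        bounded_linear_compose[OF bounded_linear_vec_nth] bounded_linear_fst bounded_linear_snd)
  then show ?thesis by (simp add: case_prod_unfold matrix_vector_mult_def)
qed

lemma calm_at_cjacobian:
  assumes "holomorphic_map_on U F" "open U" "x \<in> U"
  shows "calm_at (cjacobian F) x"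
proof -
  obtain r B where "0 < r" "\<And>y. y \<in> ball x r \<Longrightarrow> norm (cjacobian F y - cjacobian F x) \<le> B * norm (y - x)"
    by (rule cjacobian_Lipschitz_at[OF assms]) blast
  then show ?thesis
    unfolding calm_at_def eventually_nhds_metric by (metis dist_commute mem_ball)
qed

lemma continuous_on_cjacobian:
  assumes F: "holomorphic_map_on U F" and U: "open U"
  shows "continuous_on U (cjacobian F)"
proof (rule continuous_at_imp_continuous_on, rule ballI)
  fix x assume "x \<in> U"
  then have "calm_at (cjacobian F) x"
    using calm_at_cjacobian[OF F U] by blast
  then show "isCont (cjacobian F) x"
    using calm_at_imp_tendsto by (simp add: isCont_def tendsto_nhds_iff)
qed

lemma negligible_calm_image:
  fixes f :: "'a::euclidean_space \<Rightarrow> 'b::euclidean_space"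
  assumes "DIM('a) \<le> DIM('b)" "negligible S" "\<And>x. x \<in> S \<Longrightarrow> calm_at f x"
  shows "negligible (f ` S)"
  using assms(1,2)
proof (rule negligible_locally_Lipschitz_image)
  fix x assume "x \<in> S"
  then show "\<exists>T B. open T \<and> x \<in> T \<and> (\<forall>y\<in>S \<inter> T. norm (f y - f x) \<le> B * norm (y - x))"
    using assms(3)[of x] unfolding calm_at_def eventually_nhds by blast
qed

section \<open>Affine perturbations with smooth fibres\<close>

text \<open>
  A parametric form of Sard's theorem that needs only a count of parameters. Rows of \<open>J x + A\<close> are
  dependent if and only if some row \<open>i\<close> is a combination, with coefficients \<open>\<mu>\<close>,
  of the other rows. So \<open>(A, c)\<close> is determined by \<open>x\<close>, by the rows other than
  \<open>i\<close> and by \<open>\<mu>\<close>. As row \<open>i\<close> itself is then redundant, its slot in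
  the matrix \<open>B\<close> can store \<open>x\<close>. This way the bad pairs \<open>(A, c)\<close> are
  covered by finitely many calm images of the hyperplanes \<open>\<mu>\<^sub>i = 0\<close> in a space of the
  same dimension as the space of pairs.
\<close>

lemma negligible_singular_perturbations:
  fixes J :: "complex^'n \<Rightarrow> complex^'n^'m" and \<Phi> :: "complex^'n \<Rightarrow> complex^'n^'m \<Rightarrow> complex^'m"
  assumes J: "\<And>x. x \<in> U \<Longrightarrow> calm_at J x"
    and \<Phi>: "\<And>x A. x \<in> U \<Longrightarrow> calm_at (\<lambda>(x, A). \<Phi> x A) (x, A)"
  shows "negligible {(A, c). \<exists>x\<in>U. \<Phi> x A = c \<and> \<not> surj ((*v) (J x + A))}"
proof -
  \<comment> \<open>\<open>M i B \<mu>\<close> is \<open>B\<close> with row \<open>i\<close> replaced by the combination of the rows with coefficients \<open>\<mu>\<close>; on \<open>S i\<close>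
    row \<open>i\<close> of \<open>B\<close> has coefficient \<open>0\<close>, so the point stored there does not enter.\<close>
  define M where "M i B \<mu> = (\<chi> j l. if j = i then \<Sum>k\<in>UNIV. \<mu> $ k * B $ k $ l else B $ j $ l)"
    for i and B :: "complex^'n^'m" and \<mu> :: "complex^'m"
  define \<Psi> where "\<Psi> i = (\<lambda>(B, \<mu>). (M i B \<mu> - J (B $ i), \<Phi> (B $ i) (M i B \<mu> - J (B $ i))))" for i
  define S where "S i = {(B :: complex^'n^'m, \<mu> :: complex^'m). \<mu> $ i = 0 \<and> B $ i \<in> U}" for i
  have calm_entry: "calm_at (\<lambda>z. fst z $ j $ l) z" "calm_at (\<lambda>z. snd z $ j) z" "calm_at (\<lambda>z. fst z $ j) z"
    for z :: "(complex^'n^'m) \<times> (complex^'m)" and j l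
    by (intro bounded_linear_imp_calm_at bounded_linear_compose[OF bounded_linear_vec_nth]
        bounded_linear_fst bounded_linear_snd)+
  have calm_M: "calm_at (\<lambda>z. M i (fst z) (snd z)) z" for i z
    unfolding M_def
  proof (intro calm_at_vec_lambda)
    fix j l
    show "calm_at (\<lambda>z. if j = i then \<Sum>k\<in>UNIV. snd z $ k * fst z $ k $ l else fst z $ j $ l) z"
      by (cases "j = i") (auto intro!: calm_at_sum calm_at_mult calm_entry)
  qed
  have "calm_at (\<Psi> i) z" if "z \<in> S i" for i z
  proof -
    have U: "fst z $ i \<in> U" using that by (auto simp: S_def)
    have A: "calm_at (\<lambda>z. M i (fst z) (snd z) - J (fst z $ i)) z"
      by (rule calm_at_diff[OF calm_M calm_at_compose[where g = J, OF calm_entry(3) J[OF U]]])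
    have "calm_at (\<lambda>z. (\<lambda>(x, A). \<Phi> x A) (fst z $ i, M i (fst z) (snd z) - J (fst z $ i))) z"
      by (rule calm_at_compose[where g = "\<lambda>(x, A). \<Phi> x A", OF calm_at_Pair[OF calm_entry(3) A] \<Phi>[OF U]])
    from calm_at_Pair[OF A this] show ?thesis
      by (simp add: \<Psi>_def case_prod_unfold)
  qed
  moreover have "negligible (S i)" for i
  proof (rule negligible_subset)
    let ?a = "(0, axis i 1) :: (complex^'n^'m) \<times> (complex^'m)"
    have "?a \<noteq> 0" by (auto simp: zero_prod_def vec_eq_iff axis_def)
    then show "negligible {z. ?a \<bullet> z = 0}" by (rule negligible_hyperplane[OF disjI1])
    show "S i \<subseteq> {z. ?a \<bullet> z = 0}" by (auto simp: S_def inner_axis')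
  qed
  ultimately have neg: "negligible (\<Union>i. \<Psi> i ` S i)"
    by (intro negligible_Union) (auto intro!: negligible_calm_image)
  show ?thesis
  proof (rule negligible_subset[OF neg], clarsimp)
    fix A x assume x: "x \<in> U" and "\<not> surj ((*v) (J x + A))"
    then obtain c i where c: "(\<Sum>j\<in>UNIV. c j *s row j (J x + A)) = 0" "c i \<noteq> 0"
      unfolding matrix_right_invertible_surjective[symmetric] matrix_right_invertible_independent_rows
      by blast
    define \<mu> where "\<mu> = (\<chi> j. if j = i then 0 else - c j / c i)"
    define B where "B = (\<chi> j. if j = i then x else (J x + A) $ j)"
    have "M i B \<mu> $ j $ l = (J x + A) $ j $ l" for j l
    proof (cases "j = i")
      case True
      have "(\<Sum>j\<in>UNIV. c j * (J x + A) $ j $ l) = 0"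
        using c(1) by (simp add: vec_eq_iff row_def)
      then have "c i * (J x + A) $ i $ l + (\<Sum>j\<in>UNIV - {i}. c j * (J x + A) $ j $ l) = 0"
        by (subst (asm) sum.remove[of _ i]) auto
      then have "(J x + A) $ i $ l = - (\<Sum>j\<in>UNIV - {i}. c j * (J x + A) $ j $ l) / c i"
        using c(2) by (simp add: field_simps eq_neg_iff_add_eq_0)
      also have "\<dots> = (\<Sum>j\<in>UNIV - {i}. (- c j / c i) * (J x + A) $ j $ l)"
        by (simp add: sum_divide_distrib sum_negf)
      also have "\<dots> = (\<Sum>j\<in>UNIV - {i}. \<mu> $ j * B $ j $ l)"
        by (intro sum.cong) (auto simp: \<mu>_def B_def)
      also have "\<dots> = (\<Sum>j\<in>UNIV. \<mu> $ j * B $ j $ l)"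
        by (intro sum.mono_neutral_left) (auto simp: \<mu>_def)
      finally show ?thesis using True by (simp add: M_def)
    qed (simp add: M_def B_def)
    then have "M i B \<mu> = J x + A" by (simp add: vec_eq_iff)
    then have "\<Psi> i (B, \<mu>) = (A, \<Phi> x A)"
      by (simp add: \<Psi>_def B_def)
    moreover have "(B, \<mu>) \<in> S i" using x by (simp add: S_def B_def \<mu>_def)
    ultimately show "\<exists>i. (A, \<Phi> x A) \<in> \<Psi> i ` S i" by (metis imageI)
  qed
qed

text \<open>
  With the constant Jacobian \<open>J\<close> and a surjective \<open>\<Phi>\<close> that ignores
  \<open>A\<close>, the preceding lemma says that the matrices \<open>A\<close> for which \<open>J + A\<close>
  is not surjective form a null set.
\<close>

lemma surjective_perturbation:
  fixes J :: "complex^'n^'m"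
  assumes card: "CARD('m) \<le> CARD('n)" and e: "0 < e"
  obtains A where "norm A < e" "surj ((*v) (J + A))"
proof -
  obtain i :: "'m \<Rightarrow> 'n" where i: "inj i"
    using card_le_inj[of "UNIV :: 'm set" "UNIV :: 'n set"] card by auto
  \<comment> \<open>Any surjective linear map of \<open>x\<close> would serve; this one is a coordinate projection.\<close>
  define \<Phi> where "\<Phi> x (A :: complex^'n^'m) = (\<chi> k. x $ i k)" for x :: "complex^'n" and A
  have "calm_at (\<lambda>z. \<chi> k. fst z $ i k) (x, A)" for x :: "complex^'n" and A :: "complex^'n^'m"
    by (intro calm_at_vec_lambda bounded_linear_imp_calm_at
        bounded_linear_compose[OF bounded_linear_vec_nth] bounded_linear_fst)
  then have \<Phi>: "calm_at (\<lambda>(x, A). \<Phi> x A) (x, A)" for x A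
    by (simp add: \<Phi>_def case_prod_unfold)
  have J: "calm_at (\<lambda>x :: complex^'n. J) x" for x
    by (intro differentiable_imp_calm_at) simp
  from negligible_singular_perturbations[of UNIV "\<lambda>_. J" \<Phi>, OF J \<Phi>]
  have "negligible {(A, c). \<exists>x\<in>UNIV. \<Phi> x A = c \<and> \<not> surj ((*v) (J + A))}" .
  moreover have "(\<chi> k. (\<chi> j. c $ inv_into UNIV i j) $ i k) = c" for c :: "complex^'m"
    using i by (simp add: vec_eq_iff)
  then have "\<exists>x. \<Phi> x A = c" for A c
    unfolding \<Phi>_def by blast
  ultimately have neg: "negligible {(A, c :: complex^'m). \<not> surj ((*v) (J + A))}" by simp
  have "\<not> negligible (ball 0 e \<times> (UNIV :: (complex^'m) set) :: ((complex^'n^'m) \<times> _) set)"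
    using e by (intro open_not_negligible open_Times) auto
  then obtain z :: "(complex^'n^'m) \<times> (complex^'m)"
    where "z \<in> ball 0 e \<times> UNIV" "z \<notin> {(A, c). \<not> surj ((*v) (J + A))}"
    using negligible_subset[OF neg] by blast
  then show thesis using that by (cases z) auto
qed

text \<open>
  With \<open>R\<close> a right inverse of the surjective differential of \<open>F + A0\<close> at
  \<open>0\<close>, the map \<open>(A, y) \<mapsto> (A, F (R y) + A (R y))\<close> has the identity as its
  derivative at \<open>(A0, 0)\<close>, hence covers a neighbourhood of \<open>(A0, 0)\<close>.
\<close>

lemma perturbed_fibre_nonempty:
  fixes F :: "complex^'n \<Rightarrow> complex^'m"
  assumes F: "holomorphic_map_on U F" and U: "open U" "0 \<in> U" and F0: "F 0 = 0"
    and r: "0 < r" and surj: "surj ((*v) (cjacobian F 0 + A0))"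
  obtains W where "open W" "(A0, 0) \<in> W" "\<And>A c. (A, c) \<in> W \<Longrightarrow> \<exists>x. norm x < r \<and> F x + A *v x = c"
proof -
  obtain R where R: "(cjacobian F 0 + A0) ** R = mat 1"
    using surj unfolding matrix_right_invertible_surjective[symmetric] by blast
  define \<Omega> where "\<Omega> = (\<lambda>(A, y). (A, F (R *v y) + A *v (R *v y)))"
  define S where "S = {(A :: complex^'n^'m, y). R *v y \<in> U}"
  define T where "T = S \<inter> {(A, y). R *v y \<in> ball 0 r}"
  have contR: "continuous_on UNIV (\<lambda>z :: (complex^'n^'m) \<times> (complex^'m). R *v snd z)"
    by (intro linear_continuous_on bounded_linear_compose[OF matrix_vector_mul_bounded_linear] bounded_linear_snd)
  have "S = (\<lambda>z. R *v snd z) -` U" "T = S \<inter> (\<lambda>z. R *v snd z) -` ball 0 r"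
    by (auto simp: S_def T_def)
  then have open_ST: "open S" "open T"
    using U(1) contR by (auto intro!: open_Int open_vimage)
  have T: "T \<subseteq> S" "(A0, 0) \<in> interior T" "(A0, 0) \<in> S"
    unfolding interior_open[OF open_ST(2)] using U r by (auto simp: T_def S_def)
  have mult: "continuous_on S (\<lambda>z. fst z *v (R *v snd z))"
    unfolding matrix_vector_mult_def[of "fst _"]
    by (intro continuous_intros continuous_on_subset[OF contR]) auto
  have cont: "continuous_on S \<Omega>"
  proof -
    have "continuous_on S (\<lambda>z. F (R *v snd z))"
      by (rule continuous_on_compose2[OF holomorphic_map_on_imp_continuous_on[OF F] continuous_on_subset[OF contR]])
        (auto simp: S_def)
    then have "continuous_on S (\<lambda>z. (fst z, F (R *v snd z) + fst z *v (R *v snd z)))"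
      by (intro continuous_intros mult)
    then show ?thesis by (simp add: \<Omega>_def case_prod_unfold)
  qed
  have der: "(\<Omega> has_derivative id) (at (A0, 0))"
  proof -
    have R': "((\<lambda>z. R *v snd z) has_derivative (\<lambda>z. R *v snd z)) (at (A0, 0))"
      by (intro bounded_linear_imp_has_derivative bounded_linear_compose[OF matrix_vector_mul_bounded_linear] bounded_linear_snd)
    have F': "((\<lambda>z. F (R *v snd z)) has_derivative (\<lambda>z. cjacobian F 0 *v (R *v snd z))) (at (A0, 0))"
      using has_derivative_compose[OF R', of F "(*v) (cjacobian F 0)"] has_derivative_cjacobian[OF F U(2)]
      by simp
    have "((\<lambda>z. fst z *v (R *v snd z)) has_derivative (\<lambda>z. A0 *v (R *v snd z))) (at (A0, 0))"
    proof -
      have comp: "((\<lambda>z. (R *v snd z) $ j) has_derivative (\<lambda>z. (R *v snd z) $ j)) (at (A0, 0))" for j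
        by (rule bounded_linear.has_derivative[OF bounded_linear_vec_nth R'])
      have ent: "((\<lambda>z. fst z $ i $ j) has_derivative (\<lambda>z. fst z $ i $ j)) (at (A0, 0))" for i j
        by (intro bounded_linear_imp_has_derivative bounded_linear_compose[OF bounded_linear_vec_nth] bounded_linear_fst)
      have "((\<lambda>z. (fst z *v (R *v snd z)) $ i) has_derivative (\<lambda>z. (A0 *v (R *v snd z)) $ i)) (at (A0, 0))" for i
        unfolding matrix_vector_mult_def[of "fst _"] matrix_vector_mult_def[of A0]
        by (rule has_derivative_eq_rhs)
          (auto simp: fun_eq_iff intro!: has_derivative_sum has_derivative_mult ent comp)
      then show ?thesis
        by (rule has_derivative_vec)
    qed
    from has_derivative_Pair[OF bounded_linear_imp_has_derivative[OF bounded_linear_fst] has_derivative_add[OF F' this]]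
    have "((\<lambda>z. (fst z, F (R *v snd z) + fst z *v (R *v snd z))) has_derivative
        (\<lambda>z. (fst z, cjacobian F 0 *v (R *v snd z) + A0 *v (R *v snd z)))) (at (A0, 0))" .
    moreover have "cjacobian F 0 *v (R *v y) + A0 *v (R *v y) = y" for y
      using R by (metis matrix_vector_mul_assoc matrix_vector_mul_lid matrix_vector_mult_add_rdistrib)
    ultimately show ?thesis by (simp add: \<Omega>_def case_prod_unfold id_def)
  qed
  have "\<Omega> (A0, 0) \<in> interior (\<Omega> ` T)"
    by (rule sussmann_open_mapping[OF open_ST(1) cont T(3) der bounded_linear_ident _ T(1,2)]) auto
  moreover have "\<Omega> (A0, 0) = (A0, 0)"
    by (simp add: \<Omega>_def F0)
  ultimately show thesis
  proof (intro that[of "interior (\<Omega> ` T)"])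
    fix A c assume "(A, c) \<in> interior (\<Omega> ` T)"
    then have "(A, c) \<in> \<Omega> ` T" using interior_subset by blast
    then obtain y where "R *v y \<in> ball 0 r" "F (R *v y) + A *v (R *v y) = c"
      by (auto simp: \<Omega>_def T_def)
    then show "\<exists>x. norm x < r \<and> F x + A *v x = c" by auto
  qed auto
qed

section \<open>Fibres of holomorphic maps that lower the dimension\<close>

lemma complex_Cauchy_Schwarz:
  fixes x y :: "complex^'n"
  shows "norm (\<Sum>i\<in>UNIV. x $ i * cnj (y $ i)) \<le> norm x * norm y"
proof -
  have "norm (\<Sum>i\<in>UNIV. x $ i * cnj (y $ i)) \<le> (\<Sum>i\<in>UNIV. \<bar>norm (x $ i)\<bar> * \<bar>norm (y $ i)\<bar>)"
    using norm_sum[of "\<lambda>i. x $ i * cnj (y $ i)" UNIV] by (simp add: norm_mult)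
  also have "\<dots> \<le> norm x * norm y" unfolding norm_vec_def by (rule L2_set_mult_ineq)
  finally show ?thesis .
qed

text \<open>
  The function \<open>\<phi> t = \<langle>\<gamma> t, \<gamma> 0\<rangle>\<close> attains its maximum modulus at
  \<open>0\<close> by the Cauchy-Schwarz inequality, so it is constant; equality in Cauchy-Schwarz then forces
  \<open>\<gamma> t = \<gamma> 0\<close>.
\<close>

lemma holomorphic_curve_in_sphere_constant:
  fixes \<gamma> :: "complex \<Rightarrow> complex^'n"
  assumes hol: "\<And>i. (\<lambda>t. \<gamma> t $ i) holomorphic_on ball 0 e"
    and e: "0 < e" and le: "\<And>t. t \<in> ball 0 e \<Longrightarrow> norm (\<gamma> t) \<le> norm (\<gamma> 0)"
    and t: "t \<in> ball 0 e"
  shows "\<gamma> t = \<gamma> 0"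
proof -
  define \<phi> where "\<phi> t = (\<Sum>i\<in>UNIV. \<gamma> t $ i * cnj (\<gamma> 0 $ i))" for t
  have \<phi>0: "\<phi> 0 = of_real ((norm (\<gamma> 0))\<^sup>2)"
    by (simp add: \<phi>_def norm_vec_def L2_set_def sum_nonneg flip: complex_norm_square)
  have "\<phi> constant_on ball 0 e"
  proof (rule maximum_modulus_principle)
    show "\<phi> holomorphic_on ball 0 e"
      unfolding \<phi>_def by (intro holomorphic_intros hol)
    show "norm (\<phi> s) \<le> norm (\<phi> 0)" if "s \<in> ball 0 e" for s
    proof -
      have "norm (\<phi> s) \<le> norm (\<gamma> s) * norm (\<gamma> 0)"
        unfolding \<phi>_def by (rule complex_Cauchy_Schwarz)
      also have "\<dots> \<le> norm (\<gamma> 0) * norm (\<gamma> 0)"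
        using le[OF that] by (intro mult_right_mono) auto
      finally show ?thesis by (simp add: \<phi>0 power2_eq_square norm_mult)
    qed
  qed (use e in auto)
  then have "\<phi> t = \<phi> 0" using t e by (auto simp: constant_on_def)
  have "inner (\<gamma> t) (\<gamma> 0) = Re (\<phi> t)"
    by (simp add: inner_vec_def \<phi>_def inner_complex_def)
  then have "inner (\<gamma> t) (\<gamma> 0) = (norm (\<gamma> 0))\<^sup>2"
    using \<open>\<phi> t = \<phi> 0\<close> \<phi>0 by simp
  then have "(norm (\<gamma> t - \<gamma> 0))\<^sup>2 = (norm (\<gamma> t))\<^sup>2 - (norm (\<gamma> 0))\<^sup>2"
    by (simp add: power2_norm_eq_inner inner_diff_left inner_diff_right inner_commute)
  also have "\<dots> \<le> 0" using le[OF t] by (simp add: power_mono)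
  finally show ?thesis by simp
qed

text \<open>
  With \<open>M\<close> the differential at \<open>x0\<close> and \<open>R\<close> a right inverse of it, the
  map \<open>E x = x - R M x + R (F x)\<close> has differential the identity at \<open>x0\<close> and satisfies
  \<open>M (E x) = F x\<close>. Hence the local inverse of \<open>E\<close> carries the line through \<open>E
  x0\<close> in the direction of a kernel vector of \<open>M\<close> into the fibre of \<open>F\<close>.
\<close>

lemma regular_fibre_contains_disc:
  fixes F :: "complex^'n \<Rightarrow> complex^'m"
  assumes F: "holomorphic_map_on U F" and U: "open U" "x0 \<in> U"
    and surj: "surj ((*v) (cjacobian F x0))" and card: "CARD('m) < CARD('n)"
  obtains \<gamma> e where "0 < e" "\<And>i. (\<lambda>t. \<gamma> t $ i) holomorphic_on ball 0 e" "\<gamma> 0 = x0"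
    "\<And>t. t \<in> ball 0 e \<Longrightarrow> \<gamma> t \<in> U \<and> F (\<gamma> t) = F x0"
    "\<And>t. t \<in> ball 0 e \<Longrightarrow> t \<noteq> 0 \<Longrightarrow> \<gamma> t \<noteq> x0"
proof -
  define M where "M = cjacobian F x0"
  obtain R where R: "M ** R = mat 1"
    using surj unfolding M_def matrix_right_invertible_surjective[symmetric] by blast
  obtain k where k: "k \<noteq> 0" "M *v k = 0" by (rule wide_matrix_has_kernel[OF card])
  define E where "E x = x - R *v (M *v x) + R *v F x" for x
  define A where "A x = mat 1 - R ** M + R ** cjacobian F x" for x
  have MR: "M *v (R *v y) = y" for y
    by (simp add: matrix_vector_mul_assoc R)
  have ME: "M *v E x = F x" for x
    by (simp add: E_def matrix_vector_mult_diff_distrib matrix_vector_right_distrib MR)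
  have A_eq: "A x *v v = v - R *v (M *v v) + R *v (cjacobian F x *v v)" for x v
    by (simp add: A_def matrix_vector_mult_diff_rdistrib matrix_vector_mult_add_rdistrib matrix_vector_mul_assoc)
  have derE: "(E has_derivative (*v) (A x)) (at x)" if "x \<in> U" for x
    unfolding E_def A_eq
    by (intro derivative_intros bounded_linear.has_derivative[OF matrix_vector_mul_bounded_linear]
        has_derivative_cjacobian[OF F that])
  let ?E' = "\<lambda>x. Blinfun ((*v) (A x))"
  have E'_apply: "blinfun_apply (?E' x) = (*v) (A x)" for x
    by (simp add: bounded_linear_Blinfun_apply)
  have derE': "(E has_derivative blinfun_apply (?E' x)) (at x)" if "x \<in> U" for x
    unfolding E'_apply by (rule derE[OF that])
  have contE': "continuous_on U ?E'"
  proof (rule continuous_on_blinfun_componentwise)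
    fix b :: "complex^'n"
    have "continuous_on U (\<lambda>x. cjacobian F x *v b)"
      unfolding matrix_vector_mult_def
      by (intro continuous_intros continuous_on_cjacobian[OF F U(1)])
    then have "continuous_on U (\<lambda>x. R *v (cjacobian F x *v b))"
      using continuous_on_compose2[OF linear_continuous_on[OF matrix_vector_mul_bounded_linear, of UNIV R]] by blast
    then show "continuous_on U (\<lambda>x. ?E' x b)"
      unfolding E'_apply A_eq by (intro continuous_intros)
  qed
  have A0: "A x0 *v v = v" for v by (simp add: A_eq M_def)
  then have inv: "id_blinfun o\<^sub>L ?E' x0 = id_blinfun"
    by (intro blinfun_eqI) (simp add: E'_apply A0)
  obtain U' V g g' where *: "open U'" "U' \<subseteq> U" "x0 \<in> U'" "open V" "E x0 \<in> V" "homeomorphism U' V E g"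
    "\<And>y. y \<in> V \<Longrightarrow> (g has_derivative (g' y)) (at y)"
    "\<And>y. y \<in> V \<Longrightarrow> g' y = inv_into UNIV (blinfun_apply (?E' (g y)))"
    "\<And>y. y \<in> V \<Longrightarrow> bij (blinfun_apply (?E' (g y)))"
    by (rule inverse_function_theorem[OF U(1) derE' contE' U(2) inv], assumption) (rule that)
  define l where "l t = E x0 + t *s k" for t
  have l_der: "(l has_derivative (\<lambda>t. t *s k)) (at t)" for t
  proof -
    have "bounded_linear (\<lambda>t::complex. t *s k)"
      by (intro bounded_linearI') (auto simp: vec_eq_iff algebra_simps)
    then show ?thesis
      unfolding l_def using has_derivative_add[OF has_derivative_const bounded_linear_imp_has_derivative] by fastforce
  qed
  have "open (l -` V)"
    using *(4) l_der has_derivative_continuous by (intro open_vimage continuous_at_imp_continuous_on) blast+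
  moreover have "0 \<in> l -` V" using *(5) by (simp add: l_def)
  ultimately obtain e where e: "0 < e" "ball 0 e \<subseteq> l -` V" using open_contains_ball by blast
  have V: "l t \<in> V" if "t \<in> ball 0 e" for t using e that by blast
  define \<gamma> where "\<gamma> t = g (l t)" for t
  have E\<gamma>: "E (\<gamma> t) = l t" if "t \<in> ball 0 e" for t
    unfolding \<gamma>_def using *(6) V[OF that] by (simp add: homeomorphism_def)
  have \<gamma>0: "\<gamma> 0 = x0"
    using *(3,6) by (simp add: \<gamma>_def l_def homeomorphism_def)
  show thesis
  proof (rule that[of e \<gamma>, OF e(1) _ \<gamma>0])
    fix i
    have "((\<lambda>t. \<gamma> t $ i) has_field_derivative (inv_into UNIV ((*v) (A (\<gamma> t))) k) $ i) (at t)" if "t \<in> ball 0 e" for t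
    proof -
      have "bij ((*v) (A (\<gamma> t)))" and g': "g' (l t) = inv_into UNIV ((*v) (A (\<gamma> t)))"
        using *(8,9)[OF V[OF that]] by (simp_all add: E'_apply \<gamma>_def)
      note lin = inverse_matrix_scale[OF this(1)]
      have "(\<gamma> has_derivative (\<lambda>s. g' (l t) (s *s k))) (at t)"
        unfolding \<gamma>_def by (rule has_derivative_compose[OF l_der *(7)[OF V[OF that]]])
      from bounded_linear.has_derivative[OF bounded_linear_vec_nth[of i] this]
      show ?thesis unfolding has_field_derivative_def
        by (rule has_derivative_eq_rhs) (simp add: fun_eq_iff g' lin mult.commute)
    qed
    then show "(\<lambda>t. \<gamma> t $ i) holomorphic_on ball 0 e"
      unfolding holomorphic_on_open[OF open_ball] by blast
  next
    fix t :: complex assume t: "t \<in> ball 0 e"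
    have "F (\<gamma> t) = M *v l t" using ME[of "\<gamma> t"] E\<gamma>[OF t] by simp
    also have "\<dots> = F x0" by (simp add: l_def matrix_vector_right_distrib vec.scale k ME)
    finally have "F (\<gamma> t) = F x0" .
    moreover have "\<gamma> t \<in> U" using *(2,6) V[OF t] by (auto simp: \<gamma>_def homeomorphism_def)
    ultimately show "\<gamma> t \<in> U \<and> F (\<gamma> t) = F x0" by blast
    show "\<gamma> t \<noteq> x0" if "t \<noteq> 0"
      using E\<gamma>[OF t] k that by (auto simp: l_def)
  qed
qed

text \<open>
  At a point of largest norm, a fibre that is smooth there would contain a nonconstant holomorphic disc on which
  the norm has a maximum at the centre.
\<close>

lemma no_compact_regular_fibre:
  fixes F :: "complex^'n \<Rightarrow> complex^'m"
  assumes F: "holomorphic_map_on U F" and U: "open U" and card: "CARD('m) < CARD('n)"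
    and compact: "compact {x \<in> U. F x = c}" and "{x \<in> U. F x = c} \<noteq> {}"
  shows "\<exists>x\<in>U. F x = c \<and> \<not> surj ((*v) (cjacobian F x))"
proof (rule ccontr)
  assume contra: "\<not> (\<exists>x\<in>U. F x = c \<and> \<not> surj ((*v) (cjacobian F x)))"
  obtain x0 where x0: "x0 \<in> U" "F x0 = c" and max: "\<And>x. x \<in> U \<Longrightarrow> F x = c \<Longrightarrow> norm x \<le> norm x0"
    using continuous_attains_sup[OF assms(4,5), of norm] by (auto intro: continuous_intros)
  have surj: "surj ((*v) (cjacobian F x0))" using contra x0 by blast
  obtain \<gamma> e where \<gamma>: "0 < e" "\<And>i. (\<lambda>t. \<gamma> t $ i) holomorphic_on ball 0 e" "\<gamma> 0 = x0"
    "\<And>t. t \<in> ball 0 e \<Longrightarrow> \<gamma> t \<in> U \<and> F (\<gamma> t) = F x0"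
    "\<And>t. t \<in> ball 0 e \<Longrightarrow> t \<noteq> 0 \<Longrightarrow> \<gamma> t \<noteq> x0"
    by (rule regular_fibre_contains_disc[OF F U x0(1) surj card]) (rule that)
  let ?t = "of_real (e / 2) :: complex"
  have t: "?t \<in> ball 0 e" "?t \<noteq> 0" using \<gamma>(1) by auto
  have "\<gamma> ?t = \<gamma> 0"
  proof (rule holomorphic_curve_in_sphere_constant[OF \<gamma>(2,1) _ t(1)])
    show "norm (\<gamma> t) \<le> norm (\<gamma> 0)" if "t \<in> ball 0 e" for t
      using \<gamma>(3,4) that max x0(2) by metis
  qed
  then show False using \<gamma>(3,5) t by metis
qed

text \<open>
  If \<open>0\<close> is an isolated zero, then \<open>F\<close> is bounded away from \<open>0\<close> on a
  small sphere, and so is \<open>F + A - c\<close> for small \<open>A\<close> and \<open>c\<close>. Hence the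
  fibre of \<open>F + A\<close> over \<open>c\<close> in the open ball is compact. The parameters with nonempty
  fibre contain an open set, and those with a singular fibre are negligible.
\<close>

lemma no_isolated_zero:
  fixes F :: "complex^'n \<Rightarrow> complex^'m"
  assumes F: "holomorphic_map_on U F" and U: "open U" "0 \<in> U" and F0: "F 0 = 0"
    and card: "CARD('m) < CARD('n)"
  shows "\<exists>x\<in>U. x \<noteq> 0 \<and> F x = 0"
proof (rule ccontr)
  assume "\<not> (\<exists>x\<in>U. x \<noteq> 0 \<and> F x = 0)"
  then have iso: "F x \<noteq> 0" if "x \<in> U" "x \<noteq> 0" for x using that by blast
  obtain r where r: "0 < r" "cball 0 r \<subseteq> U" using U open_contains_cball by blast
  have contF: "continuous_on (cball 0 r) F"
    using holomorphic_map_on_imp_continuous_on[OF F] r(2) continuous_on_subset by blast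
  obtain \<eta> where \<eta>: "0 < \<eta>" "\<And>x. norm x = r \<Longrightarrow> \<eta> \<le> norm (F x)"
  proof -
    have "continuous_on (sphere 0 r) (\<lambda>x. norm (F x))"
      using contF sphere_cball continuous_on_subset by (intro continuous_on_norm) blast
    moreover have "sphere (0 :: complex^'n) r \<noteq> {}" using r(1) by simp
    ultimately obtain x0 where "x0 \<in> sphere 0 r" "\<And>x. x \<in> sphere 0 r \<Longrightarrow> norm (F x0) \<le> norm (F x)"
      using continuous_attains_inf[OF compact_sphere] by blast
    then show thesis
      using that[of "norm (F x0)"] iso[of x0] r by force
  qed
  define C where "C = real CARD('m) * real CARD('n)"
  have C: "0 < C" by (simp add: C_def)
  have normA: "norm (A *v x) \<le> C * norm A * norm x" for A :: "complex^'n^'m" and x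
    unfolding C_def
    by (rule norm_matrix_vector_mult_le)
      (meson Finite_Cartesian_Product.norm_nth_le order_trans)
  \<comment> \<open>On the sphere of radius \<open>r\<close>, a matrix of norm less than \<open>\<delta>\<close> moves \<open>F\<close> by less than \<open>\<eta> / 2\<close>.\<close>
  define \<delta> where "\<delta> = \<eta> / (2 * C * r)"
  have \<delta>: "0 < \<delta>" using \<eta>(1) C r(1) by (simp add: \<delta>_def)
  obtain A0 where A0: "norm A0 < \<delta>" "surj ((*v) (cjacobian F 0 + A0))"
    by (rule surjective_perturbation[OF less_imp_le[OF card] \<delta>]) blast
  obtain W where W: "open W" "(A0, 0) \<in> W" "\<And>A c. (A, c) \<in> W \<Longrightarrow> \<exists>x. norm x < r \<and> F x + A *v x = c"
    by (rule perturbed_fibre_nonempty[OF F U F0 r(1) A0(2)]) blast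
  let ?W = "W \<inter> (ball 0 \<delta> \<times> ball 0 (\<eta> / 2))"
  let ?bad = "{(A, c). \<exists>x\<in>U. F x + A *v x = c \<and> \<not> surj ((*v) (cjacobian F x + A))}"
  have "negligible ?bad"
  proof (rule negligible_singular_perturbations)
    show "calm_at (cjacobian F) x" if "x \<in> U" for x
      by (rule calm_at_cjacobian[OF F U(1) that])
    show "calm_at (\<lambda>(x, A). F x + A *v x) (x, A)" if "x \<in> U" for x A
    proof -
      have "calm_at F x"
        using has_derivative_cjacobian[OF F that] by (intro differentiable_imp_calm_at) (auto simp: differentiable_def)
      then have "calm_at (\<lambda>z. F (fst z)) (x, A)"
        using calm_at_compose[OF bounded_linear_imp_calm_at[OF bounded_linear_fst], of F "(x, A)"] by simp
      from calm_at_add[OF this calm_at_matrix_vector_mult] show ?thesis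
        by (simp add: case_prod_unfold)
    qed
  qed
  moreover have "open ?W" by (intro open_Int W(1) open_Times open_ball)
  moreover have "(A0, 0) \<in> ?W" using W(2) A0(1) \<eta>(1) by simp
  ultimately have "\<not> ?W \<subseteq> ?bad"
    using negligible_subset open_not_negligible by blast
  then obtain A c where Ac: "(A, c) \<in> W" "norm A < \<delta>" "norm c < \<eta> / 2"
    and good: "\<And>x. x \<in> U \<Longrightarrow> F x + A *v x = c \<Longrightarrow> surj ((*v) (cjacobian F x + A))"
    by fastforce
  define G where "G x = F x + A *v x" for x
  have derG: "(G has_derivative (*v) (cjacobian F x + A)) (at x)" if "x \<in> U" for x
  proof -
    have "(G has_derivative (\<lambda>v. cjacobian F x *v v + A *v v)) (at x)"
      unfolding G_def
      by (intro has_derivative_add has_derivative_cjacobian[OF F that]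
          bounded_linear_imp_has_derivative matrix_vector_mul_bounded_linear)
    then show ?thesis by (simp add: matrix_vector_mult_add_rdistrib[abs_def])
  qed
  have hol: "holomorphic_map_on (ball 0 r) G"
    by (intro holomorphic_map_onI[where A = "\<lambda>x. cjacobian F x + A"] derG) (use r(2) ball_subset_cball in blast)
  have sphere: "G x \<noteq> c" if "norm x = r" for x
  proof -
    have "norm (A *v x) \<le> C * norm A * r" using normA[of A x] that by simp
    also have "\<dots> < C * \<delta> * r" using Ac(2) C r(1) by (intro mult_strict_right_mono mult_strict_left_mono)
    also have "\<dots> = \<eta> / 2" using C r(1) by (simp add: \<delta>_def)
    finally have "norm (A *v x) < \<eta> / 2" .
    then show ?thesis
      using \<eta>(2)[OF that] Ac(3) norm_triangle_ineq4[of c "A *v x"]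
      by (auto simp: G_def)
  qed
  have fibre: "{x \<in> ball 0 r. G x = c} = cball 0 r \<inter> G -` {c}"
    using sphere by force
  have "continuous_on (cball 0 r) G"
    using derG r(2) has_derivative_continuous continuous_at_imp_continuous_on subsetD by metis
  then have "closed (cball 0 r \<inter> G -` {c})"
    by (intro continuous_closed_preimage) auto
  then have "compact {x \<in> ball 0 r. G x = c}"
    unfolding fibre compact_eq_bounded_closed using bounded_Int[of "cball 0 r"] by blast
  moreover have "{x \<in> ball 0 r. G x = c} \<noteq> {}" using W(3)[OF Ac(1)] by (auto simp: G_def)
  ultimately obtain x where "x \<in> ball 0 r" "G x = c" "\<not> surj ((*v) (cjacobian G x))"
    using no_compact_regular_fibre[OF hol open_ball card] by blast
  moreover have "x \<in> U" using r(2) \<open>x \<in> ball 0 r\<close> by auto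
  ultimately show False
    using good[of x] cjacobian_eqI[OF derG[of x]] by (simp add: G_def)
qed

section \<open>Reflection groups and their fixed vectors\<close>

lemma pos_def_hermitianD:
  assumes "pos_def_hermitian H"
  shows "H (u + v) w = H u w + H v w" "H (c *s v) w = c * H v w" "H w v = cnj (H v w)"
    "H v v = 0 \<Longrightarrow> v = 0"
proof -
  show "H (u + v) w = H u w + H v w" "H (c *s v) w = c * H v w" "H w v = cnj (H v w)"
    using assms unfolding pos_def_hermitian_def by blast+
  show "v = 0" if "H v v = 0"
    using assms that unfolding pos_def_hermitian_def by (metis less_irrefl zero_complex.simps(1))
qed

lemma hermitian_diff_left:
  assumes "pos_def_hermitian H"
  shows "H (u - v) w = H u w - H v w"
  using pos_def_hermitianD(1)[OF assms, of "u - v" v w] by simp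

lemma hermitian_diff_right:
  assumes "pos_def_hermitian H"
  shows "H w (u - v) = H w u - H w v"
  using hermitian_diff_left[OF assms, of u v w] pos_def_hermitianD(3)[OF assms]
  by (metis complex_cnj_diff)

lemma hermitian_linear_form_expansion:
  assumes H: "pos_def_hermitian H"
  shows "H v u = (\<Sum>i\<in>UNIV. v $ i * H (axis i 1) u)"
proof -
  have 0: "H 0 u = 0" using pos_def_hermitianD(2)[OF H, of 0 0 u] by simp
  have sum: "H (\<Sum>i\<in>I. f i) u = (\<Sum>i\<in>I. H (f i) u)" for I and f :: "'a \<Rightarrow> complex^'a"
    by (induction I rule: infinite_finite_induct) (simp_all add: 0 pos_def_hermitianD(1)[OF H])
  have "H v u = H (\<Sum>i\<in>UNIV. v $ i *s axis i 1) u" by (simp add: basis_expansion)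
  then show ?thesis by (simp only: sum pos_def_hermitianD(2)[OF H])
qed

text \<open>
  Inverses exist because an injective endomorphism of a finite-dimensional space is bijective. The group laws
  give a meaning to the inverses that occur in \<^const>\<open>generate\<close>.
\<close>

lemma group_unitary_group:
  fixes H :: "complex^'p \<Rightarrow> complex^'p \<Rightarrow> complex"
  assumes H: "pos_def_hermitian H"
  shows "Group.group (unitary_group H)"
proof (rule groupI)
  show "\<And>x y. x \<in> carrier (unitary_group H) \<Longrightarrow> y \<in> carrier (unitary_group H) \<Longrightarrow>
      x \<otimes>\<^bsub>unitary_group H\<^esub> y \<in> carrier (unitary_group H)"
    using Vector_Spaces.linear_compose by (auto simp: unitary_group_def unitary_map_def)
  show "\<one>\<^bsub>unitary_group H\<^esub> \<in> carrier (unitary_group H)"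
    using vec.linear_id by (simp add: unitary_group_def unitary_map_def)
  show "\<And>x y z. x \<in> carrier (unitary_group H) \<Longrightarrow> y \<in> carrier (unitary_group H) \<Longrightarrow>
      z \<in> carrier (unitary_group H) \<Longrightarrow>
      x \<otimes>\<^bsub>unitary_group H\<^esub> y \<otimes>\<^bsub>unitary_group H\<^esub> z = x \<otimes>\<^bsub>unitary_group H\<^esub> (y \<otimes>\<^bsub>unitary_group H\<^esub> z)"
    by (simp add: unitary_group_def o_assoc)
  show "\<And>x. x \<in> carrier (unitary_group H) \<Longrightarrow> \<one>\<^bsub>unitary_group H\<^esub> \<otimes>\<^bsub>unitary_group H\<^esub> x = x"
    by (simp add: unitary_group_def)
  fix g assume "g \<in> carrier (unitary_group H)"
  then have g: "clinear_map g" "\<And>v w. H (g v) (g w) = H v w"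
    by (auto simp: unitary_group_def unitary_map_def)
  have "inj g"
  proof (rule injI)
    fix v w assume "g v = g w"
    then have "g (v - w) = 0" by (simp add: vec.linear_diff[OF g(1)])
    moreover have "H (0 :: complex^'p) 0 = 0" using pos_def_hermitianD(2)[OF H, of 0 0 0] by simp
    ultimately have "H (v - w) (v - w) = 0" using g(2)[of "v - w" "v - w"] by simp
    then have "v - w = 0" by (rule pos_def_hermitianD(4)[OF H])
    then show "v = w" by simp
  qed
  then obtain g' where g': "clinear_map g'" "\<And>v. g' (g v) = v" "\<And>v. g (g' v) = v"
    using vec.linear_injective_isomorphism[OF g(1)] by blast
  have "unitary_map H g'"
    unfolding unitary_map_def using g'(1,3) g(2) by metis
  then show "\<exists>g'\<in>carrier (unitary_group H). g' \<otimes>\<^bsub>unitary_group H\<^esub> g = \<one>\<^bsub>unitary_group H\<^esub>"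
    using g' by (intro bexI[of _ g']) (auto simp: unitary_group_def)
qed

lemma unitary_map_reflection_group:
  assumes "reflection_group H G" "g \<in> G"
  shows "unitary_map H g"
  using assms subgroup.subset unfolding reflection_group_def unitary_group_def by fastforce

text \<open>
  The fixed space of \<open>r\<close> together with \<open>u\<close> spans everything, so the image of \<open>1
  - r\<close> is the line through \<open>u - r u\<close>.
\<close>

lemma reflection_moves_along_line:
  assumes r: "reflection H r" and u: "r u \<noteq> u"
  shows "\<exists>c. y - r y = c *s (u - r u)"
proof -
  have lin: "clinear_map r" and dim: "vec.dim {v. r v = v} + 1 = CARD('a)"
    using r unfolding reflection_def unitary_map_def by auto
  have sub: "vec.subspace {v. r v = v}"
    by (auto intro!: vec.subspaceI simp: vec.linear_add[OF lin] vec.linear_scale[OF lin] vec.linear_0[OF lin])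
  then have "vec.dim (insert u {v. r v = v}) = CARD('a)"
    using u dim by (simp add: vec.dim_insert vec.span_eq_iff[THEN iffD2])
  then have "vec.span (insert u {v. r v = v}) = UNIV"
    using vec.dim_eq_full[of "insert u {v. r v = v}"] by (simp add: vec.dimension_def card_cart_basis)
  then obtain c where "y - c *s u \<in> {v. r v = v}"
    using vec.span_insert[of u "{v. r v = v}"] sub vec.span_eq_iff by blast
  then have "r y - c *s r u = y - c *s u"
    by (simp add: vec.linear_diff[OF lin] vec.linear_scale[OF lin])
  then have "y - r y = c *s (u - r u)"
    by (simp add: algebra_simps vec.scale_right_diff_distrib)
  then show ?thesis ..
qed

text \<open>
  Expanding \<open>H (x - r x) (x - r x)\<close> and using that \<open>r\<close> preserves \<open>H\<close>
  expresses it through \<open>H (x - r x) x\<close> and its conjugate.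
\<close>

lemma unitary_map_fixes_if_displacement_orthogonal:
  assumes H: "pos_def_hermitian H" and r: "unitary_map H r" and "H (x - r x) x = 0"
  shows "r x = x"
proof -
  have "H (x - r x) (x - r x) = - H (x - r x) (r x)"
    using assms(3) by (simp add: hermitian_diff_right[OF H])
  also have "\<dots> = H x x - H x (r x)"
    using r unfolding unitary_map_def by (simp add: hermitian_diff_left[OF H])
  also have "\<dots> = cnj (H (x - r x) x)"
    using pos_def_hermitianD(3)[OF H, of x x] pos_def_hermitianD(3)[OF H, of "r x" x]
    by (simp add: hermitian_diff_left[OF H])
  finally show ?thesis
    using assms(3) pos_def_hermitianD(4)[OF H, of "x - r x"] by simp
qed

lemma fixed_by_generators_imp_fixed:
  assumes H: "pos_def_hermitian H" and g: "g \<in> generate (unitary_group H) R"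
    and R: "R \<subseteq> carrier (unitary_group H)" "\<And>r. r \<in> R \<Longrightarrow> r v = v"
  shows "g v = v"
  using g
proof (induction rule: generate.induct)
  case (inv r)
  interpret Group.group "unitary_group H" by (rule group_unitary_group[OF H])
  have "inv\<^bsub>unitary_group H\<^esub> r \<otimes>\<^bsub>unitary_group H\<^esub> r = \<one>\<^bsub>unitary_group H\<^esub>"
    using inv R(1) by (intro l_inv) auto
  then have "(inv\<^bsub>unitary_group H\<^esub> r) (r v) = v"
    by (simp add: unitary_group_def fun_eq_iff)
  then show ?case using R(2)[OF inv] by simp
qed (auto simp: unitary_group_def R(2))

text \<open>
  Take \<open>g\<close> with fixed space of minimal dimension. Suppose that it fixes a vector \<open>v\<close>
  which a generating reflection \<open>r\<close> moves. If \<open>r (g y) = y\<close>, then \<open>g y -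
  y\<close> lies on the line of displacements of \<open>r\<close> and is orthogonal to the fixed space of
  \<open>g\<close>, in particular to \<open>v\<close>. If it were nonzero, the whole line would be orthogonal to
  \<open>v\<close>, and \<open>r\<close> would fix \<open>v\<close>. So \<open>r \<circ> g\<close> fixes only
  fixed points of \<open>g\<close>, and not \<open>v\<close>, which contradicts minimality.
\<close>

lemma reflection_group_has_generic_element:
  fixes H :: "complex^'p \<Rightarrow> complex^'p \<Rightarrow> complex"
  assumes H: "pos_def_hermitian H" and G: "reflection_group H G"
  obtains g where "g \<in> G" "\<And>v g'. g v = v \<Longrightarrow> g' \<in> G \<Longrightarrow> g' v = v"
proof -
  obtain R where R: "\<And>r. r \<in> R \<Longrightarrow> reflection H r" "G = generate (unitary_group H) R"
    using G unfolding reflection_group_def by blast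
  have sub: "subgroup G (unitary_group H)" using G unfolding reflection_group_def by blast
  define Fix where "Fix g = {v. g v = v}" for g :: "complex^'p \<Rightarrow> complex^'p"
  have Fix_subspace: "vec.subspace (Fix g)" if "g \<in> G" for g
  proof -
    have lin: "clinear_map g" using unitary_map_reflection_group[OF G that] by (simp add: unitary_map_def)
    show ?thesis
      by (auto intro!: vec.subspaceI simp: Fix_def vec.linear_add[OF lin] vec.linear_scale[OF lin] vec.linear_0[OF lin])
  qed
  have "id \<in> G" using subgroup.one_closed[OF sub] by (simp add: unitary_group_def)
  then obtain g where g: "g \<in> G" and min: "\<And>g'. g' \<in> G \<Longrightarrow> vec.dim (Fix g) \<le> vec.dim (Fix g')"
    using ex_has_least_nat[of "\<lambda>g. g \<in> G" id "\<lambda>g. vec.dim (Fix g)"] by blast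
  note ug = unitary_map_reflection_group[OF G g]
  have fixed: "r v = v" if r: "r \<in> R" and v: "g v = v" for r v
  proof (rule ccontr)
    assume "r v \<noteq> v"
    have rG: "r \<in> G" using R(2) r by (simp add: generate.incl)
    have rg: "r \<circ> g \<in> G" using subgroup.m_closed[OF sub rG g] by (simp add: unitary_group_def)
    have "Fix (r \<circ> g) \<subseteq> Fix g"
    proof
      fix y assume "y \<in> Fix (r \<circ> g)"
      then have y: "r (g y) = y" by (simp add: Fix_def)
      show "y \<in> Fix g"
      proof (rule ccontr)
        assume "y \<notin> Fix g"
        then have "r (g y) \<noteq> g y" using y by (simp add: Fix_def)
        then obtain c where c: "v - r v = c *s (g y - r (g y))"
          using reflection_moves_along_line[OF R(1)[OF r]] by blast
        have "H (g y - y) v = H (g y) (g v) - H y v" by (simp add: hermitian_diff_left[OF H] v)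
        also have "\<dots> = 0" using ug by (simp add: unitary_map_def)
        finally have "H (v - r v) v = 0" unfolding c y pos_def_hermitianD(2)[OF H] by simp
        then show False
          using unitary_map_fixes_if_displacement_orthogonal[OF H unitary_map_reflection_group[OF G rG]] \<open>r v \<noteq> v\<close>
          by blast
      qed
    qed
    moreover have "v \<in> Fix g" "v \<notin> Fix (r \<circ> g)" using v \<open>r v \<noteq> v\<close> by (simp_all add: Fix_def)
    ultimately have "Fix (r \<circ> g) \<subset> Fix g" by blast
    then have "vec.dim (Fix (r \<circ> g)) < vec.dim (Fix g)"
      using Fix_subspace[OF g] Fix_subspace[OF rg] by (intro vec.dim_psubset) (simp add: vec.span_eq_iff[THEN iffD2])
    then show False using min[OF rg] by simp
  qed
  have Rsub: "R \<subseteq> carrier (unitary_group H)"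
    using R(1) by (auto simp: reflection_def unitary_group_def)
  show thesis
  proof (rule that[OF g])
    fix v g' assume "g v = v" "g' \<in> G"
    then show "g' v = v"
      using fixed_by_generators_imp_fixed[OF H _ Rsub, of g' v] fixed R(2) by blast
  qed
qed

section \<open>Polynomial functions and orbit maps\<close>

lemma poly_eval_superset:
  assumes "finite S" "Poly_Mapping.keys P \<subseteq> S"
  shows "poly_eval P x = (\<Sum>m\<in>S. Poly_Mapping.lookup P m * (\<Prod>i\<in>UNIV. (x $ i) ^ Poly_Mapping.lookup m i))"
  unfolding poly_eval_def using assms
  by (intro sum.mono_neutral_left) (auto simp: in_keys_iff)

lemma poly_eval_add: "poly_eval (P + Q) x = poly_eval P x + poly_eval Q x"
proof -
  let ?S = "Poly_Mapping.keys P \<union> Poly_Mapping.keys Q"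
  have "Poly_Mapping.keys (P + Q) \<subseteq> ?S" by (rule Poly_Mapping.keys_add)
  then show ?thesis
    using poly_eval_superset[of ?S P x] poly_eval_superset[of ?S Q x] poly_eval_superset[of ?S "P + Q" x]
    by (simp add: lookup_add distrib_right sum.distrib)
qed

lemma poly_eval_sum:
  fixes P :: "'i \<Rightarrow> 'p::finite cpoly"
  shows "poly_eval (sum P I) x = (\<Sum>i\<in>I. poly_eval (P i) x)"
proof -
  have "poly_eval (0 :: 'p cpoly) x = 0" by (simp add: poly_eval_def)
  then show ?thesis by (induction I rule: infinite_finite_induct) (auto simp: poly_eval_add)
qed

lemma poly_eval_variable:
  "poly_eval (Poly_Mapping.single (Poly_Mapping.single i 1) c) x = c * x $ i"
proof -
  have "(\<Prod>j\<in>UNIV. (x $ j) ^ (Poly_Mapping.lookup (Poly_Mapping.single i 1) j)) = (\<Prod>j\<in>UNIV. if j = i then x $ j else 1)"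
    by (intro prod.cong) (auto simp: lookup_single when_def)
  then show ?thesis
    by (subst poly_eval_superset[of "{Poly_Mapping.single i 1}"]) (auto simp: lookup_single when_def prod.delta)
qed

text \<open>
  The derivative is required to be homogeneous over the complex numbers; its additivity is part of
  \<^const>\<open>has_derivative\<close>.
\<close>

definition complex_differentiable_at :: "(complex^'p \<Rightarrow> complex) \<Rightarrow> complex^'p \<Rightarrow> bool" where
  "complex_differentiable_at \<phi> x \<longleftrightarrow>
    (\<exists>D. (\<phi> has_derivative D) (at x) \<and> (\<forall>c v. D (c *s v) = c * D v))"

lemma complex_differentiable_at_const: "complex_differentiable_at (\<lambda>x. c) x"
  unfolding complex_differentiable_at_def by (intro exI[of _ "\<lambda>_. 0"]) simp

lemma complex_differentiable_at_nth: "complex_differentiable_at (\<lambda>x. x $ i) x"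
  unfolding complex_differentiable_at_def
  by (intro exI[of _ "\<lambda>x. x $ i"]) (auto intro: bounded_linear_imp_has_derivative)

lemma complex_differentiable_at_add:
  assumes "complex_differentiable_at \<phi> x" "complex_differentiable_at \<psi> x"
  shows "complex_differentiable_at (\<lambda>x. \<phi> x + \<psi> x) x"
proof -
  obtain D E where D: "(\<phi> has_derivative D) (at x)" "\<forall>c v. D (c *s v) = c * D v"
    and E: "(\<psi> has_derivative E) (at x)" "\<forall>c v. E (c *s v) = c * E v"
    using assms unfolding complex_differentiable_at_def by blast
  show ?thesis
    unfolding complex_differentiable_at_def
    by (rule exI, rule conjI, rule has_derivative_add[OF D(1) E(1)]) (simp add: D(2) E(2) distrib_left)
qed

lemma complex_differentiable_at_mult:
  assumes "complex_differentiable_at \<phi> x" "complex_differentiable_at \<psi> x"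
  shows "complex_differentiable_at (\<lambda>x. \<phi> x * \<psi> x) x"
proof -
  obtain D E where D: "(\<phi> has_derivative D) (at x)" "\<forall>c v. D (c *s v) = c * D v"
    and E: "(\<psi> has_derivative E) (at x)" "\<forall>c v. E (c *s v) = c * E v"
    using assms unfolding complex_differentiable_at_def by blast
  show ?thesis
    unfolding complex_differentiable_at_def
    by (rule exI, rule conjI, rule has_derivative_mult[OF D(1) E(1)]) (simp add: D(2) E(2) algebra_simps)
qed

lemma complex_differentiable_at_poly_eval: "complex_differentiable_at (poly_eval P) x"
proof -
  have sum: "complex_differentiable_at (\<lambda>x. \<Sum>i\<in>I. \<phi> i x) x"
    if "\<And>i. complex_differentiable_at (\<phi> i) x" for I :: "('a \<Rightarrow>\<^sub>0 nat) set" and \<phi>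
    by (induction I rule: infinite_finite_induct)
      (auto intro: that complex_differentiable_at_add complex_differentiable_at_const)
  have prod: "complex_differentiable_at (\<lambda>x. \<Prod>i\<in>I. \<phi> i x) x"
    if "\<And>i. complex_differentiable_at (\<phi> i) x" for I :: "'a set" and \<phi>
    by (induction I rule: infinite_finite_induct)
      (auto intro: that complex_differentiable_at_mult complex_differentiable_at_const)
  have pow: "complex_differentiable_at (\<lambda>x. (x $ i) ^ k) x" for i :: 'a and k
    by (induction k)
      (auto intro: complex_differentiable_at_nth complex_differentiable_at_mult complex_differentiable_at_const)
  show ?thesis
    unfolding poly_eval_def
    by (intro sum complex_differentiable_at_mult complex_differentiable_at_const prod pow)
qed

text \<open>
  Each component of \<open>\<omega>\<close> is a polynomial in \<open>\<omega>\<close>, namely a variable, so it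
  lies in the invariant ring.
\<close>

lemma orbit_map_invariant:
  assumes \<omega>: "orbit_map G \<omega>" and g: "g \<in> G"
  shows "\<omega> (g v) = \<omega> v"
proof -
  have "\<omega> (g v) $ i = \<omega> v $ i" for i
  proof -
    let ?X = "Poly_Mapping.single (Poly_Mapping.single i 1) 1"
    have "(\<lambda>v. poly_eval ?X (\<omega> v)) \<in> invariant_ring G"
      using \<omega> unfolding orbit_map_def by blast
    then have "poly_eval ?X (\<omega> (g v)) = poly_eval ?X (\<omega> v)"
      using g unfolding invariant_ring_def by blast
    then show ?thesis by (simp only: poly_eval_variable mult_1)
  qed
  then show ?thesis by (simp add: vec_eq_iff)
qed

lemma orbit_map_has_clinear_derivative:
  assumes \<omega>: "orbit_map G \<omega>"
  obtains D where "clinear_map D" "(\<omega> has_derivative D) (at x)"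
proof -
  have "complex_differentiable_at (\<lambda>v. \<omega> v $ i) x" for i
  proof -
    obtain P where "\<And>v. \<omega> v $ i = poly_eval P v" using \<omega> unfolding orbit_map_def by blast
    then show ?thesis using complex_differentiable_at_poly_eval by simp
  qed
  then obtain D where D: "\<And>i. ((\<lambda>v. \<omega> v $ i) has_derivative D i) (at x)" "\<And>i c v. D i (c *s v) = c * D i v"
    unfolding complex_differentiable_at_def by metis
  define L where "L v = (\<chi> i. D i v)" for v
  have der: "(\<omega> has_derivative L) (at x)"
    by (rule has_derivative_vec) (simp add: L_def D(1))
  have "clinear_map L"
  proof (rule clinear_mapI)
    show "L (u + v) = L u + L v" for u v
      using has_derivative_linear[OF der] by (rule linear_add)
    show "L (c *s v) = c *s L v" for c v by (simp add: vec_eq_iff L_def D(2))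
  qed
  then show thesis using that der by blast
qed

text \<open>
  The linear form \<open>H(\<cdot>, u)\<close> is invariant, so it is \<open>Q \<circ> \<omega>\<close> for a
  polynomial \<open>Q\<close>. Taking derivatives at \<open>0\<close> in the direction \<open>u\<close> gives
  \<open>H u u = 0\<close> by the chain rule.
\<close>

lemma orbit_map_derivative_inj_on_fixed_vectors:
  fixes H :: "complex^'p \<Rightarrow> complex^'p \<Rightarrow> complex"
  assumes H: "pos_def_hermitian H" and G: "reflection_group H G" and \<omega>: "orbit_map G \<omega>"
    and D: "(\<omega> has_derivative D) (at 0)" and u: "\<And>g. g \<in> G \<Longrightarrow> g u = u" and "D u = 0"
  shows "u = 0"
proof -
  let ?P = "\<Sum>i\<in>UNIV. Poly_Mapping.single (Poly_Mapping.single i 1) (H (axis i 1) u)"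
  have "H v u = poly_eval ?P v" for v
    unfolding poly_eval_sum poly_eval_variable
    by (subst hermitian_linear_form_expansion[OF H]) (simp add: mult.commute)
  then have "(\<lambda>v. H v u) = poly_eval ?P" by blast
  moreover have "H (g v) u = H v u" if "g \<in> G" for g v
    using unitary_map_reflection_group[OF G that] u[OF that] unfolding unitary_map_def by metis
  ultimately have "(\<lambda>v. H v u) \<in> invariant_ring G"
    unfolding invariant_ring_def by blast
  then obtain Q where Q: "(\<lambda>v. H v u) = (\<lambda>v. poly_eval Q (\<omega> v))"
    using \<omega> unfolding orbit_map_def by blast
  obtain E where E: "(poly_eval Q has_derivative E) (at (\<omega> 0))"
    using complex_differentiable_at_poly_eval unfolding complex_differentiable_at_def by blast
  have "((\<lambda>v. H v u) has_derivative (\<lambda>v. E (D v))) (at 0)"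
    unfolding Q by (rule has_derivative_compose[OF D E])
  moreover have "linear (\<lambda>v. H v u)"
    by (rule linearI)
      (simp_all add: pos_def_hermitianD(1,2)[OF H] scaleR_eq_scale scaleR_conv_of_real)
  then have "((\<lambda>v. H v u) has_derivative (\<lambda>v. H v u)) (at 0)"
    by (simp add: bounded_linear_imp_has_derivative linear_conv_bounded_linear)
  ultimately have "H u u = E (D u)" using has_derivative_unique by metis
  also have "\<dots> = 0" using \<open>D u = 0\<close> linear_0[OF has_derivative_linear[OF E]] by simp
  finally show ?thesis by (rule pos_def_hermitianD(4)[OF H])
qed

section \<open>Injective germs of reflection maps\<close>

text \<open>
  Here \<open>K\<close> is the kernel of the differential of \<open>f\<close>, and \<open>D\<close> is
  \<open>{x. T x \<in> V\<^sup>G}\<close> since the fixed space of the generic element \<open>g\<close> is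
  \<open>V\<^sup>G\<close>. If the bound fails, the dimensions leave room for a \<open>(p+1)\<close>-dimensional
  space of pairs \<open>(L1 s, L2 s)\<close>, with \<open>s\<close> indexed by \<^typ>\<open>'p option\<close>,
  that avoids the diagonal of \<open>D\<close>, and \<open>no_isolated_zero\<close> yields a small \<open>s
  \<noteq> 0\<close> with \<open>h (L1 s) = g (h (L2 s))\<close>.
\<close>

lemma injective_reflection_map_germ_corank_le:
  fixes f :: "complex^'n::finite \<Rightarrow> complex^'p::finite"
  assumes refl: "reflection_map_germ f" and inj: "injective_germ f"
  shows "corank f + CARD('n) \<le> CARD('p)"
proof (rule ccontr)
  assume large: "\<not> corank f + CARD('n) \<le> CARD('p)"
  obtain H G \<omega> h where H: "pos_def_hermitian H" and G: "reflection_group H G" and \<omega>: "orbit_map G \<omega>"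
    and h: "embedding_germ h" and f: "\<forall>\<^sub>F x in nhds 0. f x = \<omega> (h x)"
    using refl unfolding reflection_map_germ_def by blast
  obtain U where h0: "h 0 = 0" and U: "open U" "0 \<in> U" and holh: "holomorphic_map_on U h"
    and immersion: "\<And>x. x \<in> U \<Longrightarrow> inj (frechet_derivative h (at x))"
    using h unfolding embedding_germ_def by blast
  define T where "T = (*v) (cjacobian h 0)"
  have T: "clinear_map T" "(h has_derivative T) (at 0)" "inj T"
  proof -
    show "clinear_map T" unfolding T_def by (rule matrix_vector_mul_linear_gen)
    show "(h has_derivative T) (at 0)" unfolding T_def by (rule has_derivative_cjacobian[OF holh U(2)])
    then show "inj T" using immersion[OF U(2)] frechet_derivative_at by metis
  qed
  obtain g where g: "g \<in> G" and generic: "\<And>v g'. g v = v \<Longrightarrow> g' \<in> G \<Longrightarrow> g' v = v"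
    by (rule reflection_group_has_generic_element[OF H G]) blast
  have lin_g: "clinear_map g"
    using unitary_map_reflection_group[OF G g] by (simp add: unitary_map_def)
  obtain d\<omega> where d\<omega>: "clinear_map d\<omega>" "(\<omega> has_derivative d\<omega>) (at 0)"
    by (rule orbit_map_has_clinear_derivative[OF \<omega>])
  have "((\<lambda>x. \<omega> (h x)) has_derivative (\<lambda>v. d\<omega> (T v))) (at 0)"
    using has_derivative_compose[OF T(2), of \<omega> d\<omega>] d\<omega>(2) h0 by simp
  then have "(f has_derivative (\<lambda>v. d\<omega> (T v))) (at 0)"
  proof (rule has_derivative_transform_eventually)
    show "\<forall>\<^sub>F x in at 0. \<omega> (h x) = f x"
      using f unfolding eventually_at_filter by eventually_elim simp
    show "\<omega> (h 0) = f 0" using eventually_nhds_x_imp_x[OF f] by simp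
  qed simp
  then have df: "frechet_derivative f (at 0) = (\<lambda>v. d\<omega> (T v))"
    using frechet_derivative_at by metis
  define K where "K = {v. d\<omega> (T v) = 0}"
  define D where "D = {v. g (T v) = T v}"
  note lins = vec.linear_add[OF T(1)] vec.linear_scale[OF T(1)] vec.linear_0[OF T(1)]
    vec.linear_add[OF lin_g] vec.linear_scale[OF lin_g] vec.linear_0[OF lin_g]
    vec.linear_add[OF d\<omega>(1)] vec.linear_scale[OF d\<omega>(1)] vec.linear_0[OF d\<omega>(1)]
  have sub: "vec.subspace K" "vec.subspace D"
    by (auto intro!: vec.subspaceI simp: K_def D_def lins)
  have "v = 0" if "v \<in> K" "v \<in> D" for v
  proof -
    have "T v = 0"
      using orbit_map_derivative_inj_on_fixed_vectors[OF H G \<omega> d\<omega>(2), of "T v"] generic that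
      by (simp add: K_def D_def)
    then show "v = 0" using T(3) lins(3) by (metis injD)
  qed
  then have "K \<inter> D = {0}" using vec.subspace_0 sub by blast
  then have "vec.dim K + vec.dim D = vec.dim {x + y |x y. x \<in> K \<and> y \<in> D}"
    using vec.dim_sums_Int[OF sub] by simp
  also have "\<dots> \<le> CARD('n)" by (rule dim_subset_UNIV_cart_gen)
  finally have "vec.dim D + CARD('p option) \<le> 2 * CARD('n)"
    using large by (simp add: corank_def df K_def)
  then obtain L1 L2 :: "complex^('p option) \<Rightarrow> complex^'n" where L: "clinear_map L1" "clinear_map L2"
    and L_D: "\<And>s. L1 s = L2 s \<Longrightarrow> L1 s \<in> D \<Longrightarrow> s = 0"
    by (rule clinear_embedding_avoiding_diagonal[OF sub(2)]) blast
  note bl = clinear_map_imp_bounded_linear[OF L(1)] clinear_map_imp_bounded_linear[OF L(2)]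
    clinear_map_imp_bounded_linear[OF lin_g] clinear_map_imp_bounded_linear[OF T(1)]
  have L0: "L1 0 = 0" "L2 0 = 0" "g 0 = 0"
    by (simp_all add: vec.linear_0 L lin_g)
  \<comment> \<open>A linear map that is injective by the choice of \<open>L1\<close> and \<open>L2\<close>, hence bounded below; at a solution
    its value is the linear part of \<open>(g - 1) h (L1 s) = 0\<close>, which is \<open>o(s)\<close>.\<close>
  define \<Lambda> where "\<Lambda> s = (L1 s - L2 s, g (T (L1 s)) - T (L1 s))" for s
  have bl_gT: "bounded_linear (\<lambda>s. g (T (L1 s)) - T (L1 s))"
    by (intro bounded_linear_sub bounded_linear_compose[OF bl(3)] bounded_linear_compose[OF bl(4)] bl(1))
  have "bounded_linear \<Lambda>"
    unfolding \<Lambda>_def by (intro bounded_linear_Pair bounded_linear_sub bl(1,2) bl_gT)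
  moreover have "inj \<Lambda>"
  proof -
    have "s = 0" if "\<Lambda> s = 0" for s
    proof (rule L_D)
      show "L1 s = L2 s" "L1 s \<in> D"
        using that unfolding \<Lambda>_def D_def zero_prod_def by auto
    qed
    then show ?thesis
      using linear_injective_0[of \<Lambda>] \<open>bounded_linear \<Lambda>\<close> linear_conv_bounded_linear by blast
  qed
  ultimately obtain \<delta> where \<delta>: "\<delta> > 0" "\<And>s. \<delta> * norm s \<le> norm (\<Lambda> s)"
    using linear_inj_bounded_below_pos[of \<Lambda>] linear_conv_bounded_linear by blast
  have hL1: "((\<lambda>s. h (L1 s)) has_derivative (\<lambda>s. T (L1 s))) (at 0)"
    using has_derivative_compose[OF bounded_linear_imp_has_derivative[OF bl(1)], of h T 0] T(2) L0 by simp
  have "((\<lambda>s. g (h (L1 s)) - h (L1 s)) has_derivative (\<lambda>s. g (T (L1 s)) - T (L1 s))) (at 0)"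
    by (intro has_derivative_diff bounded_linear.has_derivative[OF bl(3)] hL1)
  then obtain e where e: "0 < e" "\<And>s. norm s < e \<Longrightarrow>
      norm (g (h (L1 s)) - h (L1 s) - (g (T (L1 s)) - T (L1 s))) \<le> \<delta> / 2 * norm s"
    unfolding has_derivative_at_alt using \<delta>(1) half_gt_zero[OF \<delta>(1)] by (fastforce simp: L0 h0)
  obtain V where V: "open V" "0 \<in> V" "inj_on f V" using inj unfolding injective_germ_def by blast
  obtain V' where V': "open V'" "0 \<in> V'" "\<And>x. x \<in> V' \<Longrightarrow> f x = \<omega> (h x)"
    using f unfolding eventually_nhds by blast
  define N where "N = U \<inter> V \<inter> V'"
  have N: "open N" "0 \<in> N" using U V V' by (auto simp: N_def)
  define W where "W = L1 -` N \<inter> L2 -` N \<inter> ball 0 e"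
  have "open W"
    unfolding W_def
    by (intro open_Int open_vimage N(1) linear_continuous_on bl(1,2) open_ball)
  have "0 \<in> W" using N(2) e(1) by (simp add: W_def L0)
  define F where "F s = h (L1 s) - g (h (L2 s))" for s
  have "holomorphic_map_on W F"
    unfolding holomorphic_map_on_def
  proof
    fix s assume "s \<in> W"
    then have "L1 s \<in> U" "L2 s \<in> U" by (auto simp: W_def N_def)
    then have der: "(h has_derivative (*v) (cjacobian h (L1 s))) (at (L1 s))"
      "(h has_derivative (*v) (cjacobian h (L2 s))) (at (L2 s))"
      by (auto intro: has_derivative_cjacobian[OF holh])
    let ?D = "\<lambda>v. cjacobian h (L1 s) *v L1 v - g (cjacobian h (L2 s) *v L2 v)"
    have "(F has_derivative ?D) (at s)"
      unfolding F_def
      by (intro has_derivative_diff bounded_linear.has_derivative[OF bl(3)]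
          has_derivative_compose[OF bounded_linear_imp_has_derivative[OF bl(1)] der(1)]
          has_derivative_compose[OF bounded_linear_imp_has_derivative[OF bl(2)] der(2)])
    moreover have "clinear_map ?D"
      by (rule clinear_mapI)
        (simp_all add: lins vec.linear_add[OF L(1)] vec.linear_add[OF L(2)] vec.linear_scale[OF L(1)]
          vec.linear_scale[OF L(2)] matrix_vector_right_distrib vec.scale vec.scale_right_diff_distrib)
    ultimately show "\<exists>D. clinear_map D \<and> (F has_derivative D) (at s)" by blast
  qed
  moreover have "F 0 = 0" by (simp add: F_def L0 h0)
  ultimately obtain s where s: "s \<in> W" "s \<noteq> 0" "F s = 0"
    using no_isolated_zero[of W F] \<open>open W\<close> \<open>0 \<in> W\<close> by auto
  have mem: "L1 s \<in> N" "L2 s \<in> N" "norm s < e" using s(1) by (auto simp: W_def)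
  have hg: "h (L1 s) = g (h (L2 s))" using s(3) by (simp add: F_def)
  then have "f (L1 s) = f (L2 s)"
    using V'(3) mem orbit_map_invariant[OF \<omega> g] by (simp add: N_def)
  then have eq: "L1 s = L2 s"
    using V(3) mem by (auto simp: N_def inj_on_def)
  then have "g (h (L1 s)) - h (L1 s) = 0" using hg by simp
  then have "norm (g (T (L1 s)) - T (L1 s)) \<le> \<delta> / 2 * norm s"
    using e(2)[OF mem(3)] by (simp add: norm_minus_commute)
  moreover have "norm (\<Lambda> s) = norm (g (T (L1 s)) - T (L1 s))"
    using eq by (simp add: \<Lambda>_def norm_Pair)
  ultimately have "\<delta> * norm s \<le> \<delta> / 2 * norm s" using \<delta>(2)[of s] by simp
  then show False using \<delta>(1) s(2) by (simp add: mult_le_cancel_right)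
qed

theorem corollary4p6:
  "(\<nexists>f :: complex^'n::finite \<Rightarrow> complex^'p::finite.
      reflection_map_germ f \<and> injective_germ f \<and>
      int (corank f) > int CARD('p) - int CARD('n)) \<and>
   (\<nexists>f :: complex^2 \<Rightarrow> complex^3.
      reflection_map_germ f \<and> injective_germ f \<and> corank f = 2)"
proof (intro conjI notI)
  assume "\<exists>f :: complex^'n \<Rightarrow> complex^'p. reflection_map_germ f \<and> injective_germ f \<and>
      int (corank f) > int CARD('p) - int CARD('n)"
  then show False using injective_reflection_map_germ_corank_le by fastforce
next
  assume "\<exists>f :: complex^2 \<Rightarrow> complex^3. reflection_map_germ f \<and> injective_germ f \<and> corank f = 2"
  then show False using injective_reflection_map_germ_corank_le by fastforce
qed

end
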